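(* A strategy of the chair is outcome-equivalent to the insertion-sort strategy if and only if it is lexicographic.
   Context: Let $\mathcal{X}=\{1,\dots,n\}$ be a finite set of alternatives, labelled so that the chair's preference (a ranking) is $1\succ 2\succ\cdots\succ n$. A proto-ranking is an irreflexive transitive relation on $\mathcal{X}$; a ranking is a total proto-ranking; a tournament is a total asymmetric relation on $\mathcal{X}$. Interaction: given a tournament $\mathrel{W}$, set $R_0=\varnothing$; in each period $t\geq1$ with $R_{t-1}$ not total, the chair offers a pair $\{x,y\}$ unranked by $R_{t-1}$, the winner is $x$ if $x\mathrel{W}y$ and $y$ otherwise, and $R_t$ is the transitive closure of $R_{t-1}\cup\{(\text{winner},\text{loser})\}$; stop when $R_t$ is total. A history is a sequence of (winner, loser) pairs that can arise this way; a strategy assigns to each non-terminal history a pair unranked at it. The outcome $R^\sigma(\mathrel{W})$ of $\sigma$ under $\mathrel{W}$ is the final ranking. Two strategies are outcome-equivalent if they have the same outcome under every tournament. The insertion-sort strategy: at a history with current proto-ranking $R$, let $L(z)=\{w: z\succ w,\ \text{neither } zRw \text{ nor } wRz\}$; let $x$ be the $\succ$-worst alternative with $L(x)\ne\varnothing$, and $y$ the $R$-highest element of $L(x)$; offer $\{x,y\}$. Let $\mathcal{W}$ be the set of all tournaments on $\mathcal{X}$. For a strategy $\sigma$, alternative $x$ and $\mathrel{W}\in\mathcal{W}$, let $N^\sigma_x(\mathrel{W})=|\{y: x\succ y,\ x\, R^\sigma(\mathrel{W})\, y\}|$. Strategy $\sigma$ is better for $x$ than $\sigma'$ if for each $k\in\{1,\dots,n-1\}$,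 $|\{\mathrel{W}\in\mathcal{W}: N^\sigma_x(\mathrel{W})\ge k\}|\ge|\{\mathrel{W}\in\mathcal{W}: N^{\sigma'}_x(\mathrel{W})\ge k\}|$. Given a set $\Sigma$ of strategies, $\sigma\in\Sigma$ is best for $x$ among $\Sigma$ if it is better for $x$ than every $\sigma'\in\Sigma$. A strategy is lexicographic if, among all strategies, it is best for $1$; among such strategies, it is best for $2$; among such strategies, best for $3$; and so on (i.e. with $B_0$ the set of all strategies and $B_k$ the set of strategies in $B_{k-1}$ that are best for $k$ among $B_{k-1}$, the strategy lies in every $B_k$). *)

theory Defs
  imports Main
begin

text \<open>Alternatives are X = {1..n} (natural numbers); the chair's preference
  1 > 2 > ... > n means: x is chair-preferred to y iff x < y.
  Relations are sets of pairs; (a,b) in R means a is ranked above b.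
  A history is a list of (winner, loser) pairs.  A strategy maps histories to
  an ordered pair (x,y), which represents the offered unordered pair {x,y}.\<close>

type_synonym alt = nat
type_synonym history = "(alt \<times> alt) list"
type_synonym strategy = "history \<Rightarrow> alt \<times> alt"

definition alts :: "nat \<Rightarrow> alt set" where
  "alts n = {1..n}"

definition is_total :: "nat \<Rightarrow> (alt \<times> alt) set \<Rightarrow> bool" where
  "is_total n R \<longleftrightarrow> (\<forall>x\<in>alts n. \<forall>y\<in>alts n. x \<noteq> y \<longrightarrow> (x,y) \<in> R \<or> (y,x) \<in> R)"

definition unranked :: "nat \<Rightarrow> (alt \<times> alt) set \<Rightarrow> alt \<Rightarrow> alt \<Rightarrow> bool" where
  "unranked n R x y \<longleftrightarrow> x \<in> alts n \<and> y \<in> alts n \<and> x \<noteq> y \<and> (x,y) \<notin> R \<and> (y,x) \<notin> R"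

definition tournaments :: "nat \<Rightarrow> (alt \<times> alt) set set" where
  "tournaments n = {W. W \<subseteq> alts n \<times> alts n \<and> asym W \<and> is_total n W}"

definition rel_of :: "history \<Rightarrow> (alt \<times> alt) set" where
  "rel_of h = trancl (set h)"

definition terminal :: "nat \<Rightarrow> history \<Rightarrow> bool" where
  "terminal n h \<longleftrightarrow> is_total n (rel_of h)"

inductive hist_under :: "nat \<Rightarrow> (alt \<times> alt) set \<Rightarrow> history \<Rightarrow> bool" for n W where
  Nil: "hist_under n W []"
| Snoc: "hist_under n W h \<Longrightarrow> \<not> terminal n h \<Longrightarrow> unranked n (rel_of h) x y \<Longrightarrow>
         (x,y) \<in> W \<Longrightarrow> hist_under n W (h @ [(x,y)])"

definition is_history :: "nat \<Rightarrow> history \<Rightarrow> bool" where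
  "is_history n h \<longleftrightarrow> (\<exists>W\<in>tournaments n. hist_under n W h)"

definition is_strategy :: "nat \<Rightarrow> strategy \<Rightarrow> bool" where
  "is_strategy n \<sigma> \<longleftrightarrow>
     (\<forall>h. is_history n h \<and> \<not> terminal n h \<longrightarrow> unranked n (rel_of h) (fst (\<sigma> h)) (snd (\<sigma> h)))"

definition strategies :: "nat \<Rightarrow> strategy set" where
  "strategies n = {\<sigma>. is_strategy n \<sigma>}"

inductive play :: "nat \<Rightarrow> strategy \<Rightarrow> (alt \<times> alt) set \<Rightarrow> history \<Rightarrow> bool" for n \<sigma> W where
  Nil: "play n \<sigma> W []"
| Snoc: "play n \<sigma> W h \<Longrightarrow> \<not> terminal n h \<Longrightarrow> \<sigma> h = (x,y) \<Longrightarrow>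
         play n \<sigma> W (h @ [if (x,y) \<in> W then (x,y) else (y,x)])"

definition outcome :: "nat \<Rightarrow> strategy \<Rightarrow> (alt \<times> alt) set \<Rightarrow> (alt \<times> alt) set" where
  "outcome n \<sigma> W = (THE R. \<exists>h. play n \<sigma> W h \<and> terminal n h \<and> R = rel_of h)"

definition outcome_equiv :: "nat \<Rightarrow> strategy \<Rightarrow> strategy \<Rightarrow> bool" where
  "outcome_equiv n \<sigma> \<sigma>' \<longleftrightarrow> (\<forall>W\<in>tournaments n. outcome n \<sigma> W = outcome n \<sigma>' W)"

definition L_set :: "nat \<Rightarrow> (alt \<times> alt) set \<Rightarrow> alt \<Rightarrow> alt set" where
  "L_set n R z = {w \<in> alts n. z < w \<and> unranked n R z w}"

definition insertion_sort :: "nat \<Rightarrow> strategy" where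
  "insertion_sort n h =
     (let R = rel_of h;
          x = Max {z \<in> alts n. L_set n R z \<noteq> {}};
          y = (SOME y. y \<in> L_set n R x \<and> (\<forall>w\<in>L_set n R x. (w, y) \<notin> R))
      in (x, y))"

definition N_count :: "nat \<Rightarrow> strategy \<Rightarrow> alt \<Rightarrow> (alt \<times> alt) set \<Rightarrow> nat" where
  "N_count n \<sigma> x W = card {y \<in> alts n. x < y \<and> (x, y) \<in> outcome n \<sigma> W}"

definition better_for :: "nat \<Rightarrow> alt \<Rightarrow> strategy \<Rightarrow> strategy \<Rightarrow> bool" where
  "better_for n x \<sigma> \<sigma>' \<longleftrightarrow>
     (\<forall>k\<in>{1..n-1}. card {W \<in> tournaments n. N_count n \<sigma> x W \<ge> k}
                  \<ge> card {W \<in> tournaments n. N_count n \<sigma>' x W \<ge> k})"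

definition best_among :: "nat \<Rightarrow> alt \<Rightarrow> strategy set \<Rightarrow> strategy \<Rightarrow> bool" where
  "best_among n x \<Sigma> \<sigma> \<longleftrightarrow> \<sigma> \<in> \<Sigma> \<and> (\<forall>\<sigma>'\<in>\<Sigma>. better_for n x \<sigma> \<sigma>')"

fun B_set :: "nat \<Rightarrow> nat \<Rightarrow> strategy set" where
  "B_set n 0 = strategies n"
| "B_set n (Suc k) = {\<sigma> \<in> B_set n k. best_among n (Suc k) (B_set n k) \<sigma>}"

definition lexicographic :: "nat \<Rightarrow> strategy \<Rightarrow> bool" where
  "lexicographic n \<sigma> \<longleftrightarrow> (\<forall>k\<in>{0..n}. \<sigma> \<in> B_set n k)"

end

theory Submission
  imports Defs
begin

text \<open>Call an offer \<open>{x, y}\<close> with \<open>x < y\<close> a top offer if \<open>y\<close> is ranked above every other worse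
  alternative still unranked with \<open>x\<close>. As long as all offers involving \<open>1, \<dots>, k\<close> as the better
  alternative are top offers, they have no effect on the ranking of the alternatives worse than them;
  if this holds for all \<open>k\<close>, each \<open>x\<close> is inserted from the top into the ranking of
  \<open>{x+1, \<dots>, n}\<close>, so the outcome depends only on the tournament.

  By induction on \<open>k\<close>, the strategies that are successively best for \<open>1, \<dots>, k\<close> are
  those making top offers for \<open>1, \<dots>, k\<close>. Given this for \<open>k\<close>, let \<open>x = k + 1\<close>. At a history
  where \<open>x\<close> is not yet above any worse alternative and \<open>a\<close> of them are above \<open>x\<close>, at least
  \<open>j\<close> of them end up above \<open>x\<close> in a fraction of at least \<open>2 ^ (a - j)\<close> of the compatible tournaments:
  half of these tournaments let \<open>x\<close> lose its next comparison, and offers not involving \<open>x\<close>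
  never create a worse alternative below it. Top offers for \<open>x\<close> attain all the bounds. Conversely, if
  all the bounds are attained then nothing may overtake \<open>x\<close> after a first win against some \<open>y\<close>,
  which forces \<open>y\<close> to be on top: any \<open>z\<close> unranked with \<open>x\<close> after that win lies above \<open>x\<close>
  in some linear extension.\<close>

section \<open>Adding one comparison to a proto-ranking\<close>

definition proto :: "nat \<Rightarrow> (alt \<times> alt) set \<Rightarrow> bool" where
  "proto n R \<longleftrightarrow> R \<subseteq> alts n \<times> alts n \<and> trans R \<and> irrefl R"

definition worse_above :: "nat \<Rightarrow> (alt \<times> alt) set \<Rightarrow> alt \<Rightarrow> alt set" where
  "worse_above n R x = {z \<in> alts n. x < z \<and> (z, x) \<in> R}"

definition worse_below :: "nat \<Rightarrow> (alt \<times> alt) set \<Rightarrow> alt \<Rightarrow> alt set" where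
  "worse_below n R x = {z \<in> alts n. x < z \<and> (x, z) \<in> R}"

text \<open>For transitive \<open>R\<close> this is the transitive closure of
  \<open>insert (p, q) R\<close> (see \<open>rel_of_snoc\<close>), written without a closure so that
  membership reduces to membership in \<open>R\<close>.\<close>

definition extend :: "alt \<Rightarrow> alt \<Rightarrow> (alt \<times> alt) set \<Rightarrow> (alt \<times> alt) set" where
  "extend p q R = R \<union> {(u, v). (u = p \<or> (u, p) \<in> R) \<and> (v = q \<or> (q, v) \<in> R)}"

text \<open>The state of an insertion of \<open>x\<close> from the top with comparisons decided by
  \<open>W\<close>: either \<open>x\<close> has only lost so far, to alternatives above all those
  still to be compared, or a win against \<open>y\<close> has ended the insertion just above
  \<open>y\<close>. The clauses on \<open>W\<close> pin down where it stops.\<close>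

definition settled :: "nat \<Rightarrow> (alt \<times> alt) set \<Rightarrow> (alt \<times> alt) set \<Rightarrow> alt \<Rightarrow> bool" where
  "settled n W R x \<longleftrightarrow>
     (\<forall>u\<in>worse_above n R x. (u, x) \<in> W \<and> (\<forall>v\<in>L_set n R x. (u, v) \<in> R)) \<and>
     (worse_below n R x = {} \<or>
        L_set n R x = {} \<and>
        (\<exists>y\<in>worse_below n R x. (x, y) \<in> W \<and> (\<forall>z\<in>worse_below n R x. z = y \<or> (y, z) \<in> R)))"

section \<open>Elementary facts on proto-rankings and linear extensions\<close>

lemma finite_alts [simp]: "finite (alts n)"
  by (simp add: alts_def)

lemma finite_above [simp]: "finite (worse_above n R x)"
  by (simp add: worse_above_def)

lemma finite_below [simp]: "finite (worse_below n R x)"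
  by (simp add: worse_below_def)

lemma proto_finite: "proto n R \<Longrightarrow> finite R"
  unfolding proto_def by (meson finite_SigmaI finite_alts finite_subset)

lemma proto_trans: "proto n R \<Longrightarrow> (x, y) \<in> R \<Longrightarrow> (y, z) \<in> R \<Longrightarrow> (x, z) \<in> R"
  unfolding proto_def by (meson transD)

lemma proto_irrefl: "proto n R \<Longrightarrow> (x, x) \<notin> R"
  unfolding proto_def by (meson irreflD)

lemma proto_asym: "proto n R \<Longrightarrow> (x, y) \<in> R \<Longrightarrow> (y, x) \<notin> R"
  by (meson proto_irrefl proto_trans)

lemma proto_alts: "proto n R \<Longrightarrow> (x, y) \<in> R \<Longrightarrow> x \<in> alts n \<and> y \<in> alts n"
  unfolding proto_def by auto

lemma mem_extend:
  "(u, v) \<in> extend p q R \<longleftrightarrow> (u, v) \<in> R \<or> (u = p \<or> (u, p) \<in> R) \<and> (v = q \<or> (q, v) \<in> R)"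
  by (simp add: extend_def)

lemma unranked_sym: "unranked n R x y \<longleftrightarrow> unranked n R y x"
  by (auto simp: unranked_def)

lemma proto_extend:
  assumes "proto n R" "unranked n R p q"
  shows "proto n (extend p q R)"
proof -
  have *: "(q, p) \<notin> R" "p \<noteq> q" "p \<in> alts n" "q \<in> alts n"
    using assms(2) by (auto simp: unranked_def)
  have "extend p q R \<subseteq> alts n \<times> alts n"
    using * proto_alts[OF assms(1)] by (auto simp: mem_extend)
  moreover have "trans (extend p q R)"
    unfolding trans_def mem_extend using * proto_trans[OF assms(1)] by blast
  moreover have "irrefl (extend p q R)"
    unfolding irrefl_def mem_extend
    using * proto_trans[OF assms(1)] proto_irrefl[OF assms(1)] by blast
  ultimately show ?thesis by (simp add: proto_def)
qed

text \<open>Finite Szpilrajn: ranking one more pair by \<open>extend\<close> leaves fewer missing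
  pairs. The result is at once a ranking and a tournament, so it serves as a \<open>W\<close> under
  which a given history arises.\<close>

lemma linear_extension:
  assumes "proto n R"
  shows "\<exists>W. proto n W \<and> W \<in> tournaments n \<and> R \<subseteq> W"
  using assms
proof (induction "card (alts n \<times> alts n - R)" arbitrary: R rule: less_induct)
  case less
  show ?case
  proof (cases "is_total n R")
    case True
    then show ?thesis
      using less.prems proto_asym[OF less.prems]
      by (auto simp: tournaments_def proto_def intro!: exI[of _ R] asymI)
  next
    case False
    then obtain p q where pq: "unranked n R p q"
      by (auto simp: is_total_def unranked_def)
    have "card (alts n \<times> alts n - extend p q R) < card (alts n \<times> alts n - R)"
      using pq by (intro psubset_card_mono psubsetI) (auto simp: unranked_def extend_def)
    from less.hyps[OF this proto_extend[OF less.prems pq]]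
    show ?thesis by (auto simp: extend_def)
  qed
qed

lemma tournament_flip:
  assumes "W \<in> tournaments n" "x \<in> alts n" "y \<in> alts n" "x \<noteq> y"
  shows "(x, y) \<in> W \<longleftrightarrow> (y, x) \<notin> W"
  using assms by (auto simp: tournaments_def is_total_def dest: asymD)

section \<open>Effect of an added comparison on settled alternatives\<close>

lemma worse_partition:
  assumes "proto n R" "x \<in> alts n" "x < z" "z \<in> alts n"
  shows "z \<in> worse_above n R x \<or> z \<in> L_set n R x \<or> z \<in> worse_below n R x"
  using assms by (auto simp: worse_above_def L_set_def worse_below_def unranked_def)

lemma extend_mono_above: "worse_above n R x \<subseteq> worse_above n (extend p q R) x"
  by (auto simp: worse_above_def mem_extend)

lemma L_set_extend: "L_set n (extend p q R) x \<subseteq> L_set n R x"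
  by (auto simp: L_set_def unranked_def mem_extend)

text \<open>Since \<open>y\<close> is unranked with \<open>x\<close>, nothing worse is below
  \<open>x\<close> yet. If \<open>x\<close> wins, a new pair would join something above
  \<open>x\<close> to \<open>y\<close> or below; but whatever worse is above \<open>x\<close> is
  above \<open>y\<close> already. If \<open>x\<close> loses, new pairs end at \<open>x\<close> or
  below it, where nothing worse lies.\<close>

lemma extend_top_worse:
  assumes "proto n R" "unranked n R x y" "x < y" "(p, q) = (x, y) \<or> (p, q) = (y, x)"
    and "settled n W R x" "\<forall>z\<in>L_set n R x. z = y \<or> (y, z) \<in> R" "x < u" "x < v"
  shows "(u, v) \<in> extend p q R \<longleftrightarrow> (u, v) \<in> R"
proof
  assume uv: "(u, v) \<in> extend p q R"
  have yL: "y \<in> L_set n R x" using assms(2,3) by (auto simp: L_set_def unranked_def)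
  hence b: "worse_below n R x = {}" using assms(5) by (auto simp: settled_def)
  from assms(4) show "(u, v) \<in> R"
  proof
    assume pq: "(p, q) = (x, y)"
    show ?thesis
    proof (cases "(u, v) \<in> R")
      case False
      hence "(u, x) \<in> R" "v = y \<or> (y, v) \<in> R" using uv pq assms(7) by (auto simp: mem_extend)
      moreover have "(u, y) \<in> R"
      proof -
        have "u \<in> worse_above n R x"
          using calculation(1) assms(7) proto_alts[OF assms(1)] by (simp add: worse_above_def)
        then show ?thesis using assms(5) yL by (simp add: settled_def)
      qed
      ultimately show ?thesis using proto_trans[OF assms(1)] by blast
    qed
  next
    assume pq: "(p, q) = (y, x)"
    have "(x, v) \<notin> R"
      using assms(8) b proto_alts[OF assms(1)] by (auto simp: worse_below_def)
    then show ?thesis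
      using uv pq assms(8) by (simp add: mem_extend)
  qed
qed (simp add: mem_extend)


text \<open>All four notions look at the relation only from \<open>x\<close> downwards; with
  \<open>extend_top_worse\<close> this carries them through top offers made for better
  alternatives.\<close>

lemma worse_sets_cong:
  assumes "\<And>u v. x \<le> u \<Longrightarrow> x \<le> v \<Longrightarrow> (u, v) \<in> R' \<longleftrightarrow> (u, v) \<in> R"
  shows "worse_above n R' x = worse_above n R x"
    and "worse_below n R' x = worse_below n R x"
    and "L_set n R' x = L_set n R x"
    and "settled n W R' x \<longleftrightarrow> settled n W R x"
proof -
  have up: "(z, x) \<in> R' \<longleftrightarrow> (z, x) \<in> R" and down: "(x, z) \<in> R' \<longleftrightarrow> (x, z) \<in> R" if "x < z" for z
    using that assms[of z x] assms[of x z] by auto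
  show a: "worse_above n R' x = worse_above n R x"
    unfolding worse_above_def by (intro Collect_cong conj_cong refl) (simp add: up)
  show b: "worse_below n R' x = worse_below n R x"
    unfolding worse_below_def by (intro Collect_cong conj_cong refl) (simp add: down)
  show c: "L_set n R' x = L_set n R x"
    unfolding L_set_def unranked_def
    by (intro Collect_cong conj_cong refl) (simp_all add: up down)
  have e1: "(u, v) \<in> R' \<longleftrightarrow> (u, v) \<in> R" if "u \<in> worse_above n R x" "v \<in> L_set n R x" for u v
    using that by (intro assms) (simp_all add: worse_above_def L_set_def)
  have e2: "(u, v) \<in> R' \<longleftrightarrow> (u, v) \<in> R" if "u \<in> worse_below n R x" "v \<in> worse_below n R x" for u v
    using that by (intro assms) (simp_all add: worse_below_def)
  show "settled n W R' x \<longleftrightarrow> settled n W R x"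
    unfolding settled_def a b c by (simp add: e1 e2 cong: ball_cong bex_cong)
qed

text \<open>Everything still unranked with \<open>x\<close> is \<open>y\<close> or below
  \<open>y\<close>, so a single win places \<open>x\<close> above all of it and ends the
  insertion.\<close>

lemma extend_top_wins:
  assumes "proto n R" "unranked n R x y" "x < y" "settled n W R x"
    and "\<forall>z\<in>L_set n R x. z = y \<or> (y, z) \<in> R"
  shows "worse_above n (extend x y R) x = worse_above n R x"
    and "L_set n (extend x y R) x = {}"
    and "(x, y) \<in> W \<Longrightarrow> settled n W (extend x y R) x"
proof -
  have xy: "x \<in> alts n" "y \<in> alts n" "(y, x) \<notin> R" using assms(2) by (auto simp: unranked_def)
  have yL: "y \<in> L_set n R x" using assms(2,3) xy by (auto simp: L_set_def)
  hence b: "worse_below n R x = {}" using assms(4) by (auto simp: settled_def)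
  show a: "worse_above n (extend x y R) x = worse_above n R x"
    using xy proto_irrefl[OF assms(1)] assms(3) by (auto simp: worse_above_def mem_extend)
  show L: "L_set n (extend x y R) x = {}"
  proof -
    have "z \<notin> L_set n (extend x y R) x" if "z \<in> L_set n R x" for z
    proof -
      have "(x, z) \<in> extend x y R" using assms(5) that by (auto simp: mem_extend)
      then show ?thesis by (simp add: L_set_def unranked_def)
    qed
    then show ?thesis using L_set_extend by blast
  qed
  assume W: "(x, y) \<in> W"
  have "y \<in> worse_below n (extend x y R) x"
    using xy assms(3) by (auto simp: worse_below_def mem_extend)
  moreover have "z = y \<or> (y, z) \<in> extend x y R" if "z \<in> worse_below n (extend x y R) x" for z
  proof -
    have "z \<in> alts n" "x < z" "(x, z) \<in> extend x y R" using that by (simp_all add: worse_below_def)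
    moreover have "(x, z) \<notin> R" using calculation b by (simp add: worse_below_def)
    ultimately show ?thesis by (auto simp: mem_extend)
  qed
  ultimately show "settled n W (extend x y R) x"
    using assms(4) W unfolding settled_def a L by blast
qed

text \<open>Worse alternatives above \<open>y\<close> cannot be unranked with \<open>x\<close>, as
  \<open>y\<close> is on top of these, so they are above \<open>x\<close> already and only
  \<open>y\<close> is new. What remains unranked lies below \<open>y\<close>.\<close>

lemma extend_top_loses:
  assumes "proto n R" "unranked n R x y" "x < y" "settled n W R x"
    and "\<forall>z\<in>L_set n R x. z = y \<or> (y, z) \<in> R"
  shows "worse_above n (extend y x R) x = insert y (worse_above n R x)"
    and "worse_below n (extend y x R) x = {}"
    and "(y, x) \<in> W \<Longrightarrow> settled n W (extend y x R) x"
proof -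
  have xy: "x \<in> alts n" "y \<in> alts n" "(y, x) \<notin> R" "(x, y) \<notin> R"
    using assms(2) by (auto simp: unranked_def)
  have yL: "y \<in> L_set n R x" using assms(2,3) xy by (auto simp: L_set_def)
  hence b0: "worse_below n R x = {}" using assms(4) by (auto simp: settled_def)
  have up: "z \<in> worse_above n R x" if "z \<in> alts n" "x < z" "(z, y) \<in> R" for z
    using worse_partition[OF assms(1) xy(1) that(2,1)] b0 assms(5) that(3)
      proto_asym[OF assms(1) that(3)] proto_irrefl[OF assms(1)] by auto
  show a: "worse_above n (extend y x R) x = insert y (worse_above n R x)"
    using xy assms(3) up unfolding worse_above_def mem_extend by blast
  show b: "worse_below n (extend y x R) x = {}"
  proof -
    have "(x, z) \<notin> extend y x R" if "z \<in> alts n" "x < z" for z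
      using that b0 xy assms(3) by (simp add: worse_below_def mem_extend)
    then show ?thesis by (simp add: worse_below_def)
  qed
  assume W: "(y, x) \<in> W"
  have L: "z \<in> L_set n R x" "z \<noteq> y" if "z \<in> L_set n (extend y x R) x" for z
    using that by (simp_all add: L_set_def unranked_def mem_extend)
  have "(u, v) \<in> extend y x R"
    if "u \<in> insert y (worse_above n R x)" "v \<in> L_set n (extend y x R) x" for u v
  proof -
    have "(u, v) \<in> R" using that(1) L[OF that(2)] assms(4,5) unfolding settled_def by blast
    then show ?thesis by (simp add: extend_def)
  qed
  then show "settled n W (extend y x R) x"
    using assms(4) W unfolding settled_def a b by blast
qed

text \<open>For settled \<open>x\<close> the worse alternatives fall into those above
  \<open>x\<close>, unranked with \<open>x\<close>, and below \<open>x\<close>, the last two not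
  both inhabited; members of different classes are ranked already. An unranked pair lies in one
  class, so ranking it cannot move \<open>x\<close>.\<close>

lemma extend_worse:
  assumes "proto n R" "unranked n R p q" "x < p" "x < q" "settled n W R x"
  shows "worse_above n (extend p q R) x = worse_above n R x"
    and "worse_below n (extend p q R) x = worse_below n R x"
    and "L_set n (extend p q R) x = L_set n R x"
    and "settled n W (extend p q R) x"
proof -
  have pq: "p \<in> alts n" "q \<in> alts n" "(p, q) \<notin> R" "(q, p) \<notin> R"
    using assms(2) by (auto simp: unranked_def)
  note tr = proto_trans[OF assms(1)]
  have s1: "\<And>u v. u \<in> worse_above n R x \<Longrightarrow> v \<in> L_set n R x \<Longrightarrow> (u, v) \<in> R"
    and s2: "worse_below n R x = {} \<or> L_set n R x = {}"
    using assms(5) by (auto simp: settled_def)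
  have up: "(u, x) \<in> extend p q R \<longleftrightarrow> (u, x) \<in> R" for u
  proof -
    have "(p, x) \<in> R" if qx: "(q, x) \<in> R"
    proof -
      have xa: "x \<in> alts n" using proto_alts[OF assms(1) qx] by simp
      have "q \<in> worse_above n R x" using qx pq assms(4) by (simp add: worse_above_def)
      hence "p \<notin> L_set n R x" using s1 pq by blast
      moreover have "p \<notin> worse_below n R x" using tr[OF qx, of p] pq by (auto simp: worse_below_def)
      ultimately show ?thesis
        using worse_partition[OF assms(1) xa assms(3) pq(1)] by (auto simp: worse_above_def)
    qed
    then show ?thesis using assms(3,4) by (auto simp: mem_extend intro: tr)
  qed
  have down: "(x, v) \<in> extend p q R \<longleftrightarrow> (x, v) \<in> R" for v
  proof -
    have "(x, q) \<in> R" if xp: "(x, p) \<in> R"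
    proof -
      have xa: "x \<in> alts n" using proto_alts[OF assms(1) xp] by simp
      have "p \<in> worse_below n R x" using xp pq assms(3) by (simp add: worse_below_def)
      hence "q \<notin> L_set n R x" using s2 by blast
      moreover have "q \<notin> worse_above n R x" using tr[OF _ xp, of q] pq by (auto simp: worse_above_def)
      ultimately show ?thesis
        using worse_partition[OF assms(1) xa assms(4) pq(2)] by (auto simp: worse_below_def)
    qed
    then show ?thesis using assms(3,4) by (auto simp: mem_extend intro: tr)
  qed
  show a: "worse_above n (extend p q R) x = worse_above n R x"
    and b: "worse_below n (extend p q R) x = worse_below n R x"
    and c: "L_set n (extend p q R) x = L_set n R x"
    by (auto simp: worse_above_def worse_below_def L_set_def unranked_def up down)
  show "settled n W (extend p q R) x"
    using assms(5) unfolding settled_def a b c by (auto simp: extend_def)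
qed

text \<open>Every new pair starts at \<open>p\<close> or at something above \<open>p\<close>, and
  \<open>x\<close> is neither.\<close>

lemma extend_below_empty:
  assumes "proto n R" "worse_below n R x = {}" "x < p" "x < q" "p \<in> alts n"
  shows "worse_below n (extend p q R) x = {}"
proof -
  have "(x, z) \<notin> extend p q R" if "z \<in> alts n" "x < z" for z
    using that assms by (simp add: worse_below_def mem_extend)
  then show ?thesis by (simp add: worse_below_def)
qed

text \<open>If \<open>i\<close> is better than \<open>x\<close>, both offered alternatives are worse
  than \<open>i\<close>; if \<open>i = x\<close>, its insertion advances or ends; if
  \<open>i\<close> is worse than \<open>x\<close>, then \<open>x <= k\<close>, so the offer is a top
  offer and changes nothing from \<open>i\<close> downwards.\<close>

lemma settled_step:
  assumes "proto n R" "unranked n R x y" "x < y" "(p, q) = (x, y) \<or> (p, q) = (y, x)"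
    and "(p, q) \<in> W" "\<And>j. j \<le> k \<Longrightarrow> settled n W R j"
    and "x \<le> k \<Longrightarrow> \<forall>z\<in>L_set n R x. z = y \<or> (y, z) \<in> R" "i \<le> k"
  shows "settled n W (extend p q R) i"
proof (cases i x rule: linorder_cases)
  case less
  have pq: "unranked n R p q" using assms(2,4) by (auto simp: unranked_def)
  have "i < p" "i < q" using less assms(3,4) by auto
  then show ?thesis by (rule extend_worse(4)[OF assms(1) pq _ _ assms(6)[OF assms(8)]])
next
  case equal
  have st: "settled n W R x" and top: "\<forall>z\<in>L_set n R x. z = y \<or> (y, z) \<in> R"
    using assms(6,7,8) equal by simp_all
  from assms(4) show ?thesis
  proof
    assume "(p, q) = (x, y)"
    then show ?thesis using extend_top_wins(3)[OF assms(1-3) st top] assms(5) equal by simp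
  next
    assume "(p, q) = (y, x)"
    then show ?thesis using extend_top_loses(3)[OF assms(1-3) st top] assms(5) equal by simp
  qed
next
  case greater
  hence xk: "x \<le> k" using assms(8) by simp
  have "(u, v) \<in> extend p q R \<longleftrightarrow> (u, v) \<in> R" if "i \<le> u" "i \<le> v" for u v
    using that greater by (intro extend_top_worse[OF assms(1-4) assms(6)[OF xk] assms(7)[OF xk]]) simp_all
  from worse_sets_cong(4)[OF this] show ?thesis using assms(6)[OF assms(8)] by simp
qed

lemma settled_empty: "settled n W {} x"
  by (simp add: settled_def worse_above_def worse_below_def)

text \<open>By downward induction on \<open>k\<close>: in both rankings the alternatives above \<open>k\<close> form an
  initial segment of the same order, and the tournament fixes where that segment ends.\<close>

lemma settled_total_unique:
  assumes R: "proto n R" "is_total n R" "\<And>i. i \<le> n \<Longrightarrow> settled n W R i"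
    and S: "proto n S" "is_total n S" "\<And>i. i \<le> n \<Longrightarrow> settled n W S i"
    and W: "W \<in> tournaments n"
  shows "R = S"
proof -
  \<comment> \<open>If \<open>z\<close> were above \<open>k\<close> in \<open>S\<close> but below it
    in \<open>R\<close>, then the \<open>y\<close> that \<open>k\<close> beat in \<open>R\<close> is
    \<open>z\<close> or above \<open>z\<close>, hence above \<open>k\<close> in \<open>S\<close>.
    Being settled in \<open>S\<close> then requires \<open>y\<close> to beat \<open>k\<close> in
    \<open>W\<close>.\<close>
  have half: "worse_above n S k \<subseteq> worse_above n R k"
    if R: "proto n R" "is_total n R" "settled n W R k"
      and S: "proto n S" "is_total n S" "settled n W S k"
      and k: "k \<in> alts n"
      and eq: "\<And>u v. k < u \<Longrightarrow> k < v \<Longrightarrow> (u, v) \<in> R \<longleftrightarrow> (u, v) \<in> S" for R S k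
  proof
    fix z assume z: "z \<in> worse_above n S k"
    show "z \<in> worse_above n R k"
    proof (rule ccontr)
      assume "z \<notin> worse_above n R k"
      moreover have "L_set n R k = {}"
        using R(2) k by (auto simp: L_set_def unranked_def is_total_def)
      ultimately have zb: "z \<in> worse_below n R k"
        using worse_partition[OF R(1) k, of z] z unfolding worse_above_def by blast
      then obtain y where y: "y \<in> worse_below n R k" "(k, y) \<in> W" "z = y \<or> (y, z) \<in> R"
        using R(3) unfolding settled_def by blast
      have "k < y" "k < z" "y \<in> alts n" using y(1) zb by (simp_all add: worse_below_def)
      hence "z = y \<or> (y, z) \<in> S" using y(3) eq by blast
      moreover have "(z, k) \<in> S" using z by (simp add: worse_above_def)
      ultimately have "(y, k) \<in> S" using proto_trans[OF S(1)] by blast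
      hence "y \<in> worse_above n S k" using \<open>k < y\<close> \<open>y \<in> alts n\<close> by (simp add: worse_above_def)
      hence "(y, k) \<in> W" using S(3) by (simp add: settled_def)
      then show False using y(2) tournament_flip[OF W k \<open>y \<in> alts n\<close>] \<open>k < y\<close> by simp
    qed
  qed
  \<comment> \<open>Downward induction: \<open>m\<close> counts the alternatives already covered
    from the worst end, and \<open>n - m\<close> is the next one to be inserted.\<close>
  have "\<forall>u v. n - m < u \<longrightarrow> n - m < v \<longrightarrow> ((u, v) \<in> R \<longleftrightarrow> (u, v) \<in> S)" if "m \<le> n" for m
    using that
  proof (induction m)
    case 0
    show ?case
    proof -
      have "(u, v) \<notin> R" "(u, v) \<notin> S" if "n < u" for u v
        using that proto_alts[OF R(1), of u v] proto_alts[OF S(1), of u v] by (auto simp: alts_def)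
      then show ?thesis by simp
    qed
  next
    case (Suc m)
    define k where "k = n - m"
    have k: "k \<in> alts n" "k \<le> n" using Suc.prems by (auto simp: k_def alts_def)
    have eq: "\<And>u v. k < u \<Longrightarrow> k < v \<Longrightarrow> (u, v) \<in> R \<longleftrightarrow> (u, v) \<in> S"
      using Suc.IH Suc.prems unfolding k_def by simp
    have up: "worse_above n R k = worse_above n S k"
    proof
      show "worse_above n S k \<subseteq> worse_above n R k"
        by (rule half[OF R(1,2) R(3)[OF k(2)] S(1,2) S(3)[OF k(2)] k(1) eq])
      show "worse_above n R k \<subseteq> worse_above n S k"
        by (rule half[OF S(1,2) S(3)[OF k(2)] R(1,2) R(3)[OF k(2)] k(1) eq[symmetric]])
    qed
    have up': "(u, k) \<in> R \<longleftrightarrow> (u, k) \<in> S" if "k < u" for u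
    proof -
      have "(u, k) \<in> T \<longleftrightarrow> u \<in> worse_above n T k" if "proto n T" for T
        using \<open>k < u\<close> that by (auto simp: worse_above_def proto_def)
      then show ?thesis using up R(1) S(1) by blast
    qed
    have dual: "(k, u) \<in> T \<longleftrightarrow> u \<in> alts n \<and> (u, k) \<notin> T"
      if "k < u" "proto n T" "is_total n T" for u T
    proof -
      have "u \<in> alts n" if "(k, u) \<in> T" using that proto_alts[OF \<open>proto n T\<close>] by blast
      moreover have "(u, k) \<in> T \<or> (k, u) \<in> T" if "u \<in> alts n"
        using that \<open>k < u\<close> k(1) \<open>is_total n T\<close> by (simp add: is_total_def)
      ultimately show ?thesis using proto_asym[OF \<open>proto n T\<close>] by blast
    qed
    have dual_R: "(k, u) \<in> R \<longleftrightarrow> (k, u) \<in> S" if "k < u" for u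
      using up'[OF that] dual[OF that R(1,2)] dual[OF that S(1,2)] by simp
    have "(u, v) \<in> R \<longleftrightarrow> (u, v) \<in> S" if "k \<le> u" "k \<le> v" for u v
    proof -
      consider "k < u" "k < v" | "k < u" "v = k" | "u = k" "k < v" | "u = k" "v = k"
        using \<open>k \<le> u\<close> \<open>k \<le> v\<close> by linarith
      then show ?thesis
        by cases (simp_all add: eq up' dual_R proto_irrefl[OF R(1)] proto_irrefl[OF S(1)])
    qed
    moreover have "n - Suc m < u \<longleftrightarrow> k \<le> u" for u using Suc.prems by (auto simp: k_def)
    ultimately show ?case by simp
  qed
  from this[of n] have "(u, v) \<in> R \<longleftrightarrow> (u, v) \<in> S" if "0 < u" "0 < v" for u v using that by simp
  moreover have "0 < u \<and> 0 < v" if "(u, v) \<in> R \<union> S" for u v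
    using that proto_alts[OF R(1), of u v] proto_alts[OF S(1), of u v] by (auto simp: alts_def)
  ultimately have "e \<in> R \<longleftrightarrow> e \<in> S" for e by (cases e) blast
  then show ?thesis by (rule set_eqI)
qed

section \<open>Reachable histories and outcomes\<close>

text \<open>A strategy may return the pair in either order; this form names the better alternative
  first.\<close>

definition offers :: "strategy \<Rightarrow> history \<Rightarrow> alt \<Rightarrow> alt \<Rightarrow> bool" where
  "offers \<sigma> h x y \<longleftrightarrow> x < y \<and> (\<sigma> h = (x, y) \<or> \<sigma> h = (y, x))"

text \<open>The nodes of the game tree of \<open>\<sigma>\<close>: both answers are allowed and no
  tournament is fixed, which makes backward induction and counting over tournaments
  possible.\<close>

inductive reachable :: "nat \<Rightarrow> strategy \<Rightarrow> history \<Rightarrow> bool" for n \<sigma> where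
  Nil: "reachable n \<sigma> []"
| Snoc: "reachable n \<sigma> h \<Longrightarrow> \<not> terminal n h \<Longrightarrow> offers \<sigma> h x y \<Longrightarrow>
         (p, q) = (x, y) \<or> (p, q) = (y, x) \<Longrightarrow> reachable n \<sigma> (h @ [(p, q)])"

text \<open>Restricted to reachable histories, as choices elsewhere cannot affect an
  outcome.\<close>

definition top_offers_upto :: "nat \<Rightarrow> strategy \<Rightarrow> nat \<Rightarrow> bool" where
  "top_offers_upto n \<sigma> k \<longleftrightarrow>
     (\<forall>h x y. reachable n \<sigma> h \<and> \<not> terminal n h \<and> offers \<sigma> h x y \<and> x \<le> k \<longrightarrow>
        (\<forall>z\<in>L_set n (rel_of h) x. z = y \<or> (y, z) \<in> rel_of h))"

lemma rel_of_Nil [simp]: "rel_of [] = {}"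
  by (simp add: rel_of_def)

lemma rel_of_snoc: "rel_of (h @ [(p, q)]) = extend p q (rel_of h)"
  by (simp add: rel_of_def extend_def trancl_insert2) blast

lemma set_subset_rel_of: "set h \<subseteq> rel_of h"
  by (auto simp: rel_of_def)

lemma rel_of_subset: "set h \<subseteq> W \<Longrightarrow> trans W \<Longrightarrow> rel_of h \<subseteq> W"
  unfolding rel_of_def by (metis trancl_id trancl_mono subrelI)

lemma proto_empty: "proto n {}"
  by (simp add: proto_def irrefl_def)

lemma hist_under_proto: "hist_under n W h \<Longrightarrow> proto n (rel_of h)"
  by (induction rule: hist_under.induct) (simp_all add: proto_empty rel_of_snoc proto_extend)

text \<open>The two claims need one joint induction: \<open>is_strategy\<close> makes an offer legal
  only at an actual history, and a linear extension of the proto-ranking so far is a tournament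
  showing that the prefix is one.\<close>

lemma reachable_hist_under:
  assumes "is_strategy n \<sigma>" "reachable n \<sigma> h"
  shows "proto n (rel_of h)" and "W \<in> tournaments n \<Longrightarrow> set h \<subseteq> W \<Longrightarrow> hist_under n W h"
proof -
  have "proto n (rel_of h) \<and> (\<forall>W\<in>tournaments n. set h \<subseteq> W \<longrightarrow> hist_under n W h)"
    using assms(2)
  proof (induction rule: reachable.induct)
    case Nil
    then show ?case by (simp add: proto_empty hist_under.Nil)
  next
    case (Snoc h x y p q)
    have R: "proto n (rel_of h)"
      and hu: "\<And>W. W \<in> tournaments n \<Longrightarrow> set h \<subseteq> W \<Longrightarrow> hist_under n W h"
      using Snoc.IH by simp_all
    obtain W where W: "W \<in> tournaments n" "rel_of h \<subseteq> W"
      using linear_extension[OF R] by metis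
    hence "hist_under n W h"
      using hu[of W] set_subset_rel_of[of h] by simp
    hence "is_history n h"
      unfolding is_history_def using W(1) by (rule rev_bexI[rotated])
    hence "unranked n (rel_of h) (fst (\<sigma> h)) (snd (\<sigma> h))"
      using assms(1) Snoc.hyps(2) by (simp add: is_strategy_def)
    hence pq: "unranked n (rel_of h) p q"
      using Snoc.hyps(3,4) unranked_sym[of n "rel_of h" p q] by (auto simp: offers_def)
    have "hist_under n W (h @ [(p, q)])" if "W \<in> tournaments n" "set (h @ [(p, q)]) \<subseteq> W" for W
      using hu[of W] that by (intro hist_under.Snoc Snoc.hyps(2) pq) simp_all
    then show ?case
      using proto_extend[OF R pq] by (simp add: rel_of_snoc)
  qed
  then show "proto n (rel_of h)" "W \<in> tournaments n \<Longrightarrow> set h \<subseteq> W \<Longrightarrow> hist_under n W h"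
    by simp_all
qed

lemma reachable_history:
  assumes "is_strategy n \<sigma>" "reachable n \<sigma> h"
  obtains W where "W \<in> tournaments n" "set h \<subseteq> W" "is_history n h"
proof -
  obtain W where W: "W \<in> tournaments n" "rel_of h \<subseteq> W"
    using linear_extension[OF reachable_hist_under(1)[OF assms]] by metis
  hence h: "set h \<subseteq> W" using set_subset_rel_of[of h] by simp
  show thesis
    using that[OF W(1) h] reachable_hist_under(2)[OF assms W(1) h] W(1) unfolding is_history_def by metis
qed

lemma reachable_offer:
  assumes "is_strategy n \<sigma>" "reachable n \<sigma> h" "\<not> terminal n h"
  obtains x y where "offers \<sigma> h x y" "unranked n (rel_of h) x y"
proof -
  have u: "unranked n (rel_of h) (fst (\<sigma> h)) (snd (\<sigma> h))"
    using reachable_history[OF assms(1,2)] assms(1,3) unfolding is_strategy_def by metis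
  obtain x y where xy: "\<sigma> h = (x, y)" by force
  show thesis
  proof (cases "x < y")
    case True
    then show ?thesis using that[of x y] u xy by (simp add: offers_def)
  next
    case False
    then show ?thesis
      using that[of y x] u xy unranked_sym[of n "rel_of h" x y] by (auto simp: offers_def unranked_def)
  qed
qed

text \<open>Well-founded because either answer to an offer adds a pair to \<open>rel_of h\<close>,
  leaving fewer pairs outside it.\<close>

lemma reachable_backward_induct [consumes 2, case_names terminal offer]:
  assumes "is_strategy n \<sigma>" "reachable n \<sigma> h"
    and final: "\<And>h. reachable n \<sigma> h \<Longrightarrow> terminal n h \<Longrightarrow> P h"
    and step: "\<And>h x y. reachable n \<sigma> h \<Longrightarrow> \<not> terminal n h \<Longrightarrow> offers \<sigma> h x y \<Longrightarrow>
      unranked n (rel_of h) x y \<Longrightarrow> P (h @ [(x, y)]) \<Longrightarrow> P (h @ [(y, x)]) \<Longrightarrow> P h"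
  shows "P h"
  using assms(2)
proof (induction "card (alts n \<times> alts n - rel_of h)" arbitrary: h rule: less_induct)
  case less
  show ?case
  proof (cases "terminal n h")
    case True
    then show ?thesis using final less.prems by blast
  next
    case False
    obtain x y where xy: "offers \<sigma> h x y" "unranked n (rel_of h) x y"
      using reachable_offer[OF assms(1) less.prems False] .
    have "P (h @ [(p, q)])" if pq: "(p, q) = (x, y) \<or> (p, q) = (y, x)" for p q
    proof (rule less.hyps)
      show "reachable n \<sigma> (h @ [(p, q)])"
        using reachable.Snoc[OF less.prems False xy(1) pq] .
      show "card (alts n \<times> alts n - rel_of (h @ [(p, q)])) < card (alts n \<times> alts n - rel_of h)"
        unfolding rel_of_snoc using xy(2) pq
        by (intro psubset_card_mono psubsetI) (auto simp: unranked_def extend_def)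
    qed
    then show ?thesis using step[OF less.prems False xy] by blast
  qed
qed

lemma play_reachable:
  assumes "is_strategy n \<sigma>" "play n \<sigma> W h"
  shows "reachable n \<sigma> h"
  using assms(2)
proof (induction rule: play.induct)
  case Nil
  then show ?case by (rule reachable.Nil)
next
  case (Snoc h x y)
  obtain u v where "offers \<sigma> h u v"
    using reachable_offer[OF assms(1) Snoc.IH Snoc.hyps(2)] .
  then have uv: "offers \<sigma> h u v" "(x, y) = (u, v) \<or> (x, y) = (v, u)"
    using Snoc.hyps(3) by (auto simp: offers_def)
  then have "(y, x) = (u, v) \<or> (y, x) = (v, u)" by auto
  then show ?case
    using reachable.Snoc[OF Snoc.IH Snoc.hyps(2) uv] reachable.Snoc[OF Snoc.IH Snoc.hyps(2) uv(1)]
    by (simp split: if_split)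
qed

text \<open>A tournament contains exactly one order of each offered pair, so agreement with
  \<open>W\<close> dictates the answer that \<open>play\<close> records.\<close>

lemma play_iff_reachable:
  assumes "is_strategy n \<sigma>" "W \<in> tournaments n"
  shows "play n \<sigma> W h \<longleftrightarrow> reachable n \<sigma> h \<and> set h \<subseteq> W"
proof
  assume "play n \<sigma> W h"
  moreover have "set h \<subseteq> W"
    using calculation
  proof (induction rule: play.induct)
    case (Snoc h x y)
    obtain u v where uv: "offers \<sigma> h u v" "unranked n (rel_of h) u v"
      using reachable_offer[OF assms(1) play_reachable[OF assms(1) Snoc.hyps(1)] Snoc.hyps(2)] .
    hence "x \<in> alts n" "y \<in> alts n" "x \<noteq> y"
      using Snoc.hyps(3) by (auto simp: offers_def unranked_def)
    then show ?case using Snoc.IH tournament_flip[OF assms(2), of x y] by simp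
  qed simp
  ultimately show "reachable n \<sigma> h \<and> set h \<subseteq> W" using play_reachable[OF assms(1)] by blast
next
  have "reachable n \<sigma> h \<Longrightarrow> set h \<subseteq> W \<Longrightarrow> play n \<sigma> W h"
  proof (induction rule: reachable.induct)
    case Nil
    then show ?case by (simp add: play.Nil)
  next
    case (Snoc h x y p q)
    obtain u v where uv: "offers \<sigma> h u v" "unranked n (rel_of h) u v"
      using reachable_offer[OF assms(1) Snoc.hyps(1,2)] .
    hence "p \<in> alts n" "q \<in> alts n" "p \<noteq> q"
      using Snoc.hyps(3,4) by (auto simp: offers_def unranked_def)
    moreover have "(p, q) \<in> W" using Snoc.prems by simp
    moreover have "\<sigma> h = (p, q) \<or> \<sigma> h = (q, p)" using Snoc.hyps(3,4) by (auto simp: offers_def)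
    moreover have "play n \<sigma> W h" using Snoc by simp
    moreover have "(q, p) \<notin> W" using calculation tournament_flip[OF assms(2), of p q] by simp
    ultimately show ?case
      using play.Snoc[of n \<sigma> W h p q] play.Snoc[of n \<sigma> W h q p] Snoc.hyps(2) by auto
  qed
  then show "reachable n \<sigma> h \<and> set h \<subseteq> W \<Longrightarrow> play n \<sigma> W h" by blast
qed

section \<open>Determinism of play, and the outcome\<close>

lemma play_first_step:
  assumes "play n \<sigma> W (h @ e # g)"
  shows "e = (if \<sigma> h \<in> W then \<sigma> h else (snd (\<sigma> h), fst (\<sigma> h)))"
  using assms
proof (induction g rule: rev_induct)
  case Nil
  then show ?case by (cases rule: play.cases) auto
next
  case (snoc a g)
  from snoc.prems have "play n \<sigma> W (h @ e # g)"
    by (cases rule: play.cases) (auto simp flip: append_Cons append_assoc)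
  then show ?case by (rule snoc.IH)
qed

text \<open>Two plays under the same \<open>W\<close> never branch, and a nonterminal one has to
  continue as \<open>h'\<close> does. This yields the uniqueness behind \<open>THE\<close> in
  \<open>outcome\<close>.\<close>

lemma play_prefix_of_terminal:
  assumes "play n \<sigma> W h" "play n \<sigma> W h'" "terminal n h'"
  shows "\<exists>g. h' = h @ g"
  using assms(1)
proof (induction rule: play.induct)
  case (Snoc h x y)
  then obtain g where g: "h' = h @ g" by blast
  then obtain e g' where "g = e # g'" using Snoc.hyps(2) assms(3) by (cases g) auto
  then show ?case using play_first_step[of n \<sigma> W h e g'] assms(2) g Snoc.hyps(3) by auto
qed simp

lemma outcome_terminal:
  assumes "play n \<sigma> W h" "terminal n h"
  shows "outcome n \<sigma> W = rel_of h"
  unfolding outcome_def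
proof (rule the_equality)
  fix R assume "\<exists>h. play n \<sigma> W h \<and> terminal n h \<and> R = rel_of h"
  then obtain h' where "play n \<sigma> W h'" "terminal n h'" "R = rel_of h'" by blast
  then show "R = rel_of h"
    using play_prefix_of_terminal[OF assms(1), of h'] play_prefix_of_terminal[OF _ assms, of h']
    by auto
qed (use assms in blast)

lemma outcome_reachable:
  assumes "is_strategy n \<sigma>" "W \<in> tournaments n" "reachable n \<sigma> h" "set h \<subseteq> W"
  shows "\<exists>g. reachable n \<sigma> (h @ g) \<and> set (h @ g) \<subseteq> W \<and> terminal n (h @ g) \<and>
    outcome n \<sigma> W = rel_of (h @ g)"
  using assms(1,3,4)
proof (induction rule: reachable_backward_induct)
  case (terminal h)
  then have "outcome n \<sigma> W = rel_of h"
    by (intro outcome_terminal) (simp_all add: play_iff_reachable[OF assms(1,2)])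
  then show ?case using terminal by (intro exI[of _ "[]"]) simp
next
  case (offer h x y)
  have "x \<in> alts n" "y \<in> alts n" "x \<noteq> y" using offer.hyps(4) by (auto simp: unranked_def)
  hence "(x, y) \<in> W \<or> (y, x) \<in> W" using tournament_flip[OF assms(2)] by blast
  then obtain e where "\<exists>g. reachable n \<sigma> ((h @ [e]) @ g) \<and> set ((h @ [e]) @ g) \<subseteq> W \<and>
      terminal n ((h @ [e]) @ g) \<and> outcome n \<sigma> W = rel_of ((h @ [e]) @ g)"
    using offer.IH offer.prems by fastforce
  then show ?case unfolding append_assoc by blast
qed

lemma rel_of_mono: "set h \<subseteq> set h' \<Longrightarrow> rel_of h \<subseteq> rel_of h'"
  unfolding rel_of_def by (meson subrelI trancl_mono)

lemma outcome_props:
  assumes "is_strategy n \<sigma>" "W \<in> tournaments n"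
  shows "proto n (outcome n \<sigma> W)" and "is_total n (outcome n \<sigma> W)"
    and "reachable n \<sigma> h \<Longrightarrow> set h \<subseteq> W \<Longrightarrow> rel_of h \<subseteq> outcome n \<sigma> W"
proof -
  obtain g where g: "reachable n \<sigma> g" "terminal n g" "outcome n \<sigma> W = rel_of g"
    using outcome_reachable[OF assms reachable.Nil] by auto
  show "proto n (outcome n \<sigma> W)" "is_total n (outcome n \<sigma> W)"
    using g reachable_hist_under(1)[OF assms(1)] by (simp_all add: terminal_def)
  assume "reachable n \<sigma> h" "set h \<subseteq> W"
  then obtain g where "outcome n \<sigma> W = rel_of (h @ g)"
    using outcome_reachable[OF assms] by blast
  then show "rel_of h \<subseteq> outcome n \<sigma> W"
    using rel_of_mono[of h "h @ g"] by simp
qed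

text \<open>If \<open>W\<close> is transitive, closing the answers never leaves \<open>W\<close>,
  and a total subset of an asymmetric relation is all of it. Rankings thus serve as test tournaments
  whose outcome is known for every strategy.\<close>

lemma outcome_linear:
  assumes "is_strategy n \<sigma>" "W \<in> tournaments n" "proto n W"
  shows "outcome n \<sigma> W = W"
proof
  obtain g where g: "set g \<subseteq> W" "outcome n \<sigma> W = rel_of g"
    using outcome_reachable[OF assms(1,2) reachable.Nil] by auto
  show sub: "outcome n \<sigma> W \<subseteq> W"
    using g rel_of_subset assms(3) by (simp add: proto_def)
  show "W \<subseteq> outcome n \<sigma> W"
  proof (rule subrelI)
    fix x y assume xy: "(x, y) \<in> W"
    hence "x \<in> alts n" "y \<in> alts n" "x \<noteq> y" "(y, x) \<notin> W"
      using proto_alts[OF assms(3)] proto_asym[OF assms(3)] proto_irrefl[OF assms(3)] by blast+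
    then show "(x, y) \<in> outcome n \<sigma> W"
      using outcome_props(2)[OF assms(1,2)] sub by (auto simp: is_total_def)
  qed
qed

lemma reachable_settled:
  assumes "is_strategy n \<sigma>" "top_offers_upto n \<sigma> k" "reachable n \<sigma> h" "set h \<subseteq> W" "i \<le> k"
  shows "settled n W (rel_of h) i"
  using assms(3-5)
proof (induction arbitrary: i rule: reachable.induct)
  case Nil
  then show ?case by (simp add: settled_empty)
next
  case (Snoc h x y p q)
  have "unranked n (rel_of h) x y"
  proof -
    obtain u v where "offers \<sigma> h u v" "unranked n (rel_of h) u v"
      using reachable_offer[OF assms(1) Snoc.hyps(1,2)] .
    then show ?thesis using Snoc.hyps(3) by (auto simp: offers_def)
  qed
  then show ?case unfolding rel_of_snoc
  proof (rule settled_step[OF reachable_hist_under(1)[OF assms(1) Snoc.hyps(1)]])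
    show "x < y" using Snoc.hyps(3) by (simp add: offers_def)
    show "(p, q) = (x, y) \<or> (p, q) = (y, x)" by (rule Snoc.hyps)
    show "(p, q) \<in> W" using Snoc.prems by simp
    show "settled n W (rel_of h) j" if "j \<le> k" for j using Snoc.IH Snoc.prems that by simp
    show "\<forall>z\<in>L_set n (rel_of h) x. z = y \<or> (y, z) \<in> rel_of h" if "x \<le> k"
      using assms(2) that Snoc.hyps(1-3) unfolding top_offers_upto_def by blast
    show "i \<le> k" by (rule Snoc.prems)
  qed
qed

lemma top_offers_outcome_unique:
  assumes "is_strategy n \<sigma>" "top_offers_upto n \<sigma> n" "is_strategy n \<tau>" "top_offers_upto n \<tau> n"
    and W: "W \<in> tournaments n"
  shows "outcome n \<sigma> W = outcome n \<tau> W"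
proof -
  have st: "settled n W (outcome n \<rho> W) i"
    if \<rho>: "is_strategy n \<rho>" "top_offers_upto n \<rho> n" and "i \<le> n" for \<rho> i
  proof -
    obtain g where "reachable n \<rho> g" "set g \<subseteq> W" "outcome n \<rho> W = rel_of g"
      using outcome_reachable[OF \<rho>(1) W reachable.Nil] by auto
    then show ?thesis using reachable_settled[OF \<rho>] \<open>i \<le> n\<close> by simp
  qed
  show ?thesis
    by (rule settled_total_unique[OF outcome_props(1,2)[OF assms(1) W] st[OF assms(1,2)]
          outcome_props(1,2)[OF assms(3) W] st[OF assms(3,4)] W])
qed

section \<open>Insertion sort makes top offers only\<close>

lemma insertion_sort_offer:
  assumes "proto n R" "\<not> is_total n R"
    and x_def: "x = Max {z \<in> alts n. L_set n R z \<noteq> {}}"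
    and y_def: "y = (SOME y. y \<in> L_set n R x \<and> (\<forall>w\<in>L_set n R x. (w, y) \<notin> R))"
  shows "y \<in> L_set n R x" and "\<forall>z\<in>L_set n R x. z = y \<or> (y, z) \<in> R"
proof -
  let ?S = "{z \<in> alts n. L_set n R z \<noteq> {}}"
  obtain u v where "unranked n R u v"
    using assms(2) unfolding is_total_def unranked_def by blast
  then obtain u v where "unranked n R u v" "u < v"
    using unranked_sym[of n R u v] by (cases u v rule: linorder_cases) (auto simp: unranked_def)
  hence "v \<in> L_set n R u" "u \<in> alts n" by (simp_all add: L_set_def unranked_def)
  hence "u \<in> ?S" by blast
  hence x: "x \<in> ?S" unfolding x_def by (intro Max_in) auto
  \<comment> \<open>A finite acyclic relation is well-founded, so a nonempty \<open>L_set\<close>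
    has a highest element and \<open>SOME\<close> picks one.\<close>
  have "wf R"
    using proto_finite[OF assms(1)] assms(1)
    by (intro finite_acyclic_wf) (simp_all add: acyclic_irrefl proto_def trancl_id)
  moreover obtain w where "w \<in> L_set n R x" using x by blast
  ultimately obtain y' where "y' \<in> L_set n R x \<and> (\<forall>w\<in>L_set n R x. (w, y') \<notin> R)"
    by (metis wfE_min)
  hence y: "y \<in> L_set n R x \<and> (\<forall>w\<in>L_set n R x. (w, y) \<notin> R)"
    unfolding y_def by (rule someI)
  then show "y \<in> L_set n R x" by simp
  show "\<forall>z\<in>L_set n R x. z = y \<or> (y, z) \<in> R"
  proof
    fix z assume z: "z \<in> L_set n R x"
    \<comment> \<open>By the choice of \<open>x\<close> as a maximum, all alternatives worse than
      \<open>x\<close> are ranked among themselves; hence an undominated \<open>y\<close> dominates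
      the others.\<close>
    have rk: "\<not> unranked n R a b" if "x < a" "a < b" for a b
    proof
      assume "unranked n R a b"
      hence "b \<in> L_set n R a" "a \<in> alts n" using that by (simp_all add: L_set_def unranked_def)
      hence "a \<in> ?S" by blast
      hence "a \<le> x" unfolding x_def by (intro Max_ge) auto
      then show False using that by simp
    qed
    have "x < y" "x < z" "y \<in> alts n" "z \<in> alts n" using y z by (simp_all add: L_set_def)
    hence "z = y \<or> (y, z) \<in> R \<or> (z, y) \<in> R"
      using rk[of y z] rk[of z y] by (cases y z rule: linorder_cases) (auto simp: unranked_def)
    then show "z = y \<or> (y, z) \<in> R" using y z by blast
  qed
qed

lemma insertion_sort_is_strategy: "is_strategy n (insertion_sort n)"
  unfolding is_strategy_def
proof (intro allI impI)
  fix h assume h: "is_history n h \<and> \<not> terminal n h"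
  hence "proto n (rel_of h)" "\<not> is_total n (rel_of h)"
    using hist_under_proto by (auto simp: is_history_def terminal_def)
  from insertion_sort_offer(1)[OF this refl refl]
  show "unranked n (rel_of h) (fst (insertion_sort n h)) (snd (insertion_sort n h))"
    by (simp add: insertion_sort_def Let_def L_set_def)
qed

lemma insertion_sort_top_offers: "top_offers_upto n (insertion_sort n) k"
  unfolding top_offers_upto_def
proof (intro allI impI, elim conjE)
  fix h x y assume h: "reachable n (insertion_sort n) h" "\<not> terminal n h"
    and xy: "offers (insertion_sort n) h x y"
  have R: "proto n (rel_of h)" "\<not> is_total n (rel_of h)"
    using h reachable_hist_under(1)[OF insertion_sort_is_strategy] by (auto simp: terminal_def)
  obtain u v where uv: "insertion_sort n h = (u, v)" by force
  have "u = Max {z \<in> alts n. L_set n (rel_of h) z \<noteq> {}}"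
    and "v = (SOME y. y \<in> L_set n (rel_of h) u \<and> (\<forall>w\<in>L_set n (rel_of h) u. (w, y) \<notin> rel_of h))"
    using uv by (auto simp: insertion_sort_def Let_def)
  note * = insertion_sort_offer[OF R this]
  have "u < v" using *(1) by (simp add: L_set_def)
  hence "x = u" "y = v" using xy uv by (auto simp: offers_def)
  then show "\<forall>z\<in>L_set n (rel_of h) x. z = y \<or> (y, z) \<in> rel_of h" using *(2) by simp
qed

section \<open>Counting tournaments\<close>

definition compatible :: "nat \<Rightarrow> history \<Rightarrow> (alt \<times> alt) set set" where
  "compatible n h = {W \<in> tournaments n. set h \<subseteq> W}"

text \<open>At \<open>h = []\<close> and for all \<open>j\<close>, small values are what being
  better for \<open>x\<close> means (\<open>better_for_iff_losses\<close>); general \<open>h\<close>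
  permits recursion over the game tree.\<close>

definition losses :: "nat \<Rightarrow> strategy \<Rightarrow> alt \<Rightarrow> history \<Rightarrow> nat \<Rightarrow> nat" where
  "losses n \<sigma> x h j = card {W \<in> compatible n h. j \<le> card (worse_above n (outcome n \<sigma> W) x)}"

lemma finite_tournaments [simp]: "finite (tournaments n)"
  by (rule finite_subset[of _ "Pow (alts n \<times> alts n)"]) (auto simp: tournaments_def)

lemma finite_compatible [simp]: "finite (compatible n h)"
  by (simp add: compatible_def)

lemma losses_le: "losses n \<sigma> x h j \<le> card (compatible n h)"
  unfolding losses_def by (rule card_mono) auto

lemma card_worse: "x \<in> alts n \<Longrightarrow> card {z \<in> alts n. x < z} = n - x"
proof -
  assume "x \<in> alts n"
  hence "{z \<in> alts n. x < z} = {x<..n}" by (auto simp: alts_def)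
  then show ?thesis by simp
qed

text \<open>Reversing the pair maps either half injectively into the other. As the pair is unranked,
  neither of its orders occurs in \<open>h\<close>, so the reversal keeps agreement with
  \<open>h\<close>.\<close>

lemma compatible_split:
  assumes "unranked n (rel_of h) x y"
  shows "compatible n h = compatible n (h @ [(x, y)]) \<union> compatible n (h @ [(y, x)])"
    and "compatible n (h @ [(x, y)]) \<inter> compatible n (h @ [(y, x)]) = {}"
    and "card (compatible n (h @ [(x, y)])) = card (compatible n (h @ [(y, x)]))"
proof -
  have xy: "x \<in> alts n" "y \<in> alts n" "x \<noteq> y" "(x, y) \<notin> set h" "(y, x) \<notin> set h"
    using assms set_subset_rel_of[of h] by (auto simp: unranked_def)
  note fl = tournament_flip[OF _ xy(1,2,3)]
  show "compatible n h = compatible n (h @ [(x, y)]) \<union> compatible n (h @ [(y, x)])"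
    using fl by (auto simp: compatible_def)
  show "compatible n (h @ [(x, y)]) \<inter> compatible n (h @ [(y, x)]) = {}"
    using fl by (auto simp: compatible_def)
  have le: "card (compatible n (h @ [(u, v)])) \<le> card (compatible n (h @ [(v, u)]))"
    if uv: "u \<in> alts n" "v \<in> alts n" "u \<noteq> v" "(u, v) \<notin> set h" for u v
  proof (rule card_inj_on_le)
    let ?f = "\<lambda>W. insert (v, u) (W - {(u, v)})"
    have nvu: "(v, u) \<notin> W" if "W \<in> compatible n (h @ [(u, v)])" for W
      using that tournament_flip[OF _ uv(1-3), of W] by (simp add: compatible_def)
    show "inj_on ?f (compatible n (h @ [(u, v)]))"
    proof (rule inj_onI)
      fix W W' assume W: "W \<in> compatible n (h @ [(u, v)])" "W' \<in> compatible n (h @ [(u, v)])"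
        and eq: "?f W = ?f W'"
      have "V = insert (u, v) (?f V - {(v, u)})" if "V \<in> compatible n (h @ [(u, v)])" for V
        using that nvu[OF that] uv(3) by (auto simp: compatible_def)
      from this[OF W(1)] this[OF W(2)] show "W = W'" using eq by simp
    qed
    show "?f ` compatible n (h @ [(u, v)]) \<subseteq> compatible n (h @ [(v, u)])"
    proof (rule image_subsetI)
      fix W assume W: "W \<in> compatible n (h @ [(u, v)])"
      hence Wt: "W \<subseteq> alts n \<times> alts n" "asym W" "is_total n W" and Wh: "set h \<subseteq> W"
        by (simp_all add: compatible_def tournaments_def)
      have "asym (?f W)"
      proof (rule asymI)
        fix a b assume "(a, b) \<in> ?f W"
        then show "(b, a) \<notin> ?f W" using uv(3) asymD[OF Wt(2), of a b] by auto
      qed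
      moreover have "is_total n (?f W)"
        using Wt(3) by (auto simp: is_total_def)
      moreover have "?f W \<subseteq> alts n \<times> alts n" using Wt(1) uv by auto
      moreover have "set h \<subseteq> ?f W" using Wh uv(4) by auto
      ultimately show "?f W \<in> compatible n (h @ [(v, u)])"
        by (simp add: compatible_def tournaments_def)
    qed
  qed simp
  show "card (compatible n (h @ [(x, y)])) = card (compatible n (h @ [(y, x)]))"
    by (rule antisym) (rule le; use xy in simp)+
qed

lemma losses_split:
  assumes "unranked n (rel_of h) x y"
  shows "losses n \<sigma> k h j = losses n \<sigma> k (h @ [(x, y)]) j + losses n \<sigma> k (h @ [(y, x)]) j"
    and "card (compatible n h) = 2 * card (compatible n (h @ [(x, y)]))"
    and "card (compatible n h) = 2 * card (compatible n (h @ [(y, x)]))"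
proof -
  note sp = compatible_split[OF assms]
  let ?P = "\<lambda>W. j \<le> card (worse_above n (outcome n \<sigma> W) k)"
  have "{W \<in> compatible n h. ?P W} =
      {W \<in> compatible n (h @ [(x, y)]). ?P W} \<union> {W \<in> compatible n (h @ [(y, x)]). ?P W}"
    using sp(1) by blast
  moreover have "{W \<in> compatible n (h @ [(x, y)]). ?P W} \<inter> {W \<in> compatible n (h @ [(y, x)]). ?P W} = {}"
    using sp(2) by blast
  ultimately show "losses n \<sigma> k h j = losses n \<sigma> k (h @ [(x, y)]) j + losses n \<sigma> k (h @ [(y, x)]) j"
    unfolding losses_def by (simp add: card_Un_disjoint)
  have "card (compatible n h) =
      card (compatible n (h @ [(x, y)])) + card (compatible n (h @ [(y, x)]))"
    using sp(1,2) by (simp add: card_Un_disjoint)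
  then show "card (compatible n h) = 2 * card (compatible n (h @ [(x, y)]))"
    and "card (compatible n h) = 2 * card (compatible n (h @ [(y, x)]))"
    using sp(3) by simp_all
qed

lemma worse_above_mono: "R \<subseteq> S \<Longrightarrow> worse_above n R x \<subseteq> worse_above n S x"
  by (auto simp: worse_above_def)

lemma losses_full:
  assumes "is_strategy n \<sigma>" "reachable n \<sigma> h" "j \<le> card (worse_above n (rel_of h) x)"
  shows "losses n \<sigma> x h j = card (compatible n h)"
proof -
  have "j \<le> card (worse_above n (outcome n \<sigma> W) x)" if "W \<in> compatible n h" for W
  proof -
    have "rel_of h \<subseteq> outcome n \<sigma> W"
      using that outcome_props(3)[OF assms(1) _ assms(2)] by (simp add: compatible_def)
    from card_mono[OF finite_above worse_above_mono[OF this]] show ?thesis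
      using assms(3) by (rule le_trans[rotated])
  qed
  then have "{W \<in> compatible n h. j \<le> card (worse_above n (outcome n \<sigma> W) x)} = compatible n h"
    by blast
  then show ?thesis by (simp add: losses_def)
qed

text \<open>With nothing worse left unranked with \<open>x\<close>, the set of worse alternatives
  above \<open>x\<close> is final.\<close>

lemma losses_none:
  assumes "is_strategy n \<sigma>" "reachable n \<sigma> h" "L_set n (rel_of h) x = {}" "x \<in> alts n"
    and "card (worse_above n (rel_of h) x) < j"
  shows "losses n \<sigma> x h j = 0"
proof -
  have sub: "worse_above n (outcome n \<sigma> W) x \<subseteq> worse_above n (rel_of h) x" if W: "W \<in> compatible n h" for W
  proof
    have Wt: "W \<in> tournaments n" "set h \<subseteq> W" using W by (simp_all add: compatible_def)
    fix z assume z: "z \<in> worse_above n (outcome n \<sigma> W) x"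
    hence "z \<in> alts n" "x < z" "(z, x) \<in> outcome n \<sigma> W" by (simp_all add: worse_above_def)
    moreover have "(x, z) \<notin> outcome n \<sigma> W"
      using proto_asym[OF outcome_props(1)[OF assms(1) Wt(1)]] calculation by blast
    moreover have "rel_of h \<subseteq> outcome n \<sigma> W"
      using outcome_props(3)[OF assms(1) Wt(1) assms(2) Wt(2)] .
    ultimately have "z \<notin> worse_below n (rel_of h) x" by (auto simp: worse_below_def)
    then show "z \<in> worse_above n (rel_of h) x"
      using worse_partition[OF reachable_hist_under(1)[OF assms(1,2)] assms(4) \<open>x < z\<close> \<open>z \<in> alts n\<close>]
        assms(3) by simp
  qed
  hence "card (worse_above n (outcome n \<sigma> W) x) < j" if "W \<in> compatible n h" for W
    using card_mono[OF finite_above sub[OF that]] assms(5) by simp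
  then show ?thesis by (simp add: losses_def not_le[symmetric] cong: conj_cong)
qed

text \<open>The offer is a top offer, so \<open>extend_top_worse\<close> applies; any tournament
  containing \<open>h\<close> can serve as the \<open>W\<close> for which \<open>x\<close> is
  settled.\<close>

lemma offer_by_better:
  assumes "is_strategy n \<sigma>" "top_offers_upto n \<sigma> k" "reachable n \<sigma> h" "\<not> terminal n h"
    and "offers \<sigma> h x y" "unranked n (rel_of h) x y" "x \<le> k" "(p, q) = (x, y) \<or> (p, q) = (y, x)"
    and "k < i"
  shows "worse_above n (rel_of (h @ [(p, q)])) i = worse_above n (rel_of h) i"
    and "worse_below n (rel_of (h @ [(p, q)])) i = worse_below n (rel_of h) i"
proof -
  obtain W where "W \<in> tournaments n" "set h \<subseteq> W"
    using reachable_history[OF assms(1,3)] .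
  hence "settled n W (rel_of h) x"
    using reachable_settled[OF assms(1-3)] assms(7) by simp
  moreover have "\<forall>z\<in>L_set n (rel_of h) x. z = y \<or> (y, z) \<in> rel_of h"
    using assms(2-5,7) unfolding top_offers_upto_def by metis
  ultimately have "(u, v) \<in> rel_of (h @ [(p, q)]) \<longleftrightarrow> (u, v) \<in> rel_of h" if "i \<le> u" "i \<le> v" for u v
    unfolding rel_of_snoc
    using that assms(5-9)
    by (intro extend_top_worse[OF reachable_hist_under(1)[OF assms(1,3)] assms(6)])
      (simp_all add: offers_def)
  from worse_sets_cong(1,2)[OF this]
  show "worse_above n (rel_of (h @ [(p, q)])) i = worse_above n (rel_of h) i"
    and "worse_below n (rel_of (h @ [(p, q)])) i = worse_below n (rel_of h) i" by simp_all
qed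

text \<open>The offer may be any, not only a top one: losing to \<open>y\<close> can also lift
  alternatives above \<open>y\<close> over \<open>x\<close>, hence an inequality where
  \<open>extend_top_loses\<close> has an equality.\<close>

lemma lost_comparison:
  assumes "proto n R" "unranked n R x y" "x < y" "worse_below n R x = {}"
  shows "worse_below n (extend y x R) x = {}"
    and "Suc (card (worse_above n R x)) \<le> card (worse_above n (extend y x R) x)"
proof -
  have xy: "x \<in> alts n" "y \<in> alts n" "(y, x) \<notin> R" "(x, y) \<notin> R"
    using assms(2) by (simp_all add: unranked_def)
  have "(x, z) \<notin> extend y x R" if "z \<in> alts n" "x < z" for z
    using that assms(3,4) xy by (simp add: worse_below_def mem_extend)
  then show "worse_below n (extend y x R) x = {}" by (simp add: worse_below_def)
  have "insert y (worse_above n R x) \<subseteq> worse_above n (extend y x R) x"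
    using xy assms(3) extend_mono_above[of n R x y x] by (simp add: worse_above_def mem_extend)
  moreover have "y \<notin> worse_above n R x" using xy by (simp add: worse_above_def)
  ultimately show "Suc (card (worse_above n R x)) \<le> card (worse_above n (extend y x R) x)"
    using card_mono[OF finite_above, of "insert y (worse_above n R x)"] by simp
qed

section \<open>Bounds on the number of tournaments with at least \<open>j\<close> losses\<close>

lemma top_offers_upto_mono: "top_offers_upto n \<sigma> k \<Longrightarrow> l \<le> k \<Longrightarrow> top_offers_upto n \<sigma> l"
  unfolding top_offers_upto_def by (meson le_trans)

text \<open>The bookkeeping of a lost comparison: \<open>T\<close> counts the tournaments compatible
  with the losing branch, half of those before it, and \<open>a\<close>, \<open>b\<close> the
  alternatives above \<open>x\<close> before and after. The growth of \<open>a\<close> to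
  \<open>b\<close> pays for the factor 2.\<close>

lemma halving_bound:
  assumes "T \<le> 2 ^ (j - b) * c" "Suc a \<le> b" "a < j"
  shows "2 * T \<le> 2 ^ (j - a) * (c :: nat)"
proof -
  have "(2::nat) ^ (j - b) \<le> 2 ^ (j - Suc a)" using assms(2) by (intro power_increasing) auto
  hence "T \<le> 2 ^ (j - Suc a) * c" using assms(1) by (meson le_trans mult_le_mono1)
  moreover have "(2::nat) ^ (j - a) = 2 * 2 ^ (j - Suc a)"
    using assms(3) by (metis Suc_diff_Suc power_Suc)
  ultimately show ?thesis by simp
qed

lemma weaken_exponent:
  assumes "T \<le> 2 ^ (j - b) * c" "a \<le> b"
  shows "T \<le> 2 ^ (j - a) * (c :: nat)"
proof -
  have "(2::nat) ^ (j - b) \<le> 2 ^ (j - a)" using assms(2) by (intro power_increasing) auto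
  then show ?thesis using assms(1) by (meson le_trans mult_le_mono1)
qed

lemma card_above_terminal:
  assumes "terminal n h" "worse_below n (rel_of h) x = {}" "x \<in> alts n"
  shows "n - x \<le> card (worse_above n (rel_of h) x)"
proof -
  have "(z, x) \<in> rel_of h" if z: "z \<in> alts n" "x < z" for z
  proof -
    have "(x, z) \<notin> rel_of h" using assms(2) z by (simp add: worse_below_def)
    then show ?thesis using assms(1,3) z unfolding terminal_def is_total_def by (metis less_irrefl)
  qed
  hence "{z \<in> alts n. x < z} \<subseteq> worse_above n (rel_of h) x" by (simp add: worse_above_def subset_iff)
  from card_mono[OF finite_above this] show ?thesis using card_worse[OF assms(3)] by simp
qed

text \<open>Backward induction. An offer for a better alternative changes nothing for
  \<open>Suc k\<close>; an offer between worse ones puts nothing below it, so both branches satisfy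
  the bound. At a terminal history everything worse is above. Truncated subtraction makes the factor
  1 once \<open>j\<close> alternatives are above.\<close>

lemma losses_lower_bound:
  assumes "is_strategy n \<sigma>" "top_offers_upto n \<sigma> k" "Suc k \<le> n" "j \<le> n - Suc k" "reachable n \<sigma> h"
    and "worse_below n (rel_of h) (Suc k) = {}"
  shows "card (compatible n h) \<le>
    2 ^ (j - card (worse_above n (rel_of h) (Suc k))) * losses n \<sigma> (Suc k) h j"
  using assms(1,5,6)
proof (induction rule: reachable_backward_induct)
  case (terminal h)
  have "j \<le> card (worse_above n (rel_of h) (Suc k))"
    using card_above_terminal[OF terminal(2,3)] assms(3,4) by (simp add: alts_def)
  then show ?case using losses_full[OF assms(1) terminal(1)] by simp
next
  case (offer h x y)
  let ?a = "card (worse_above n (rel_of h) (Suc k))"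
  note R = reachable_hist_under(1)[OF assms(1) offer.hyps(1)]
  note sp = losses_split[OF offer.hyps(4)]
  have xy: "x < y" "x \<in> alts n" "y \<in> alts n" "unranked n (rel_of h) y x"
    using offer.hyps(3,4) unranked_sym[of n "rel_of h"] by (auto simp: offers_def unranked_def)
  show ?case
  proof (cases "j \<le> ?a")
    case True
    then show ?thesis using losses_full[OF assms(1) offer.hyps(1) True] by simp
  next
    case False
    consider "x \<le> k" | "x = Suc k" | "Suc k < x" by linarith
    then show ?thesis
    proof cases
      case 1
      note same = offer_by_better[OF assms(1,2) offer.hyps 1]
      have "card (compatible n (h @ [(x, y)])) \<le> 2 ^ (j - ?a) * losses n \<sigma> (Suc k) (h @ [(x, y)]) j"
        using offer.IH(1) offer.prems same[of x y "Suc k"] by simp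
      moreover have "card (compatible n (h @ [(y, x)])) \<le> 2 ^ (j - ?a) * losses n \<sigma> (Suc k) (h @ [(y, x)]) j"
        using offer.IH(2) offer.prems same[of y x "Suc k"] by simp
      ultimately show ?thesis using sp(2,3) by (simp add: sp(1) distrib_left)
    next
      case 2
      note ls = lost_comparison[OF R offer.hyps(4) xy(1)]
      \<comment> \<open>The losing branch carries the whole bound; nothing is claimed about the
        winning one.\<close>
      have "2 * card (compatible n (h @ [(y, x)])) \<le> 2 ^ (j - ?a) * losses n \<sigma> (Suc k) (h @ [(y, x)]) j"
      proof (rule halving_bound)
        show "card (compatible n (h @ [(y, x)])) \<le>
            2 ^ (j - card (worse_above n (rel_of (h @ [(y, x)])) (Suc k))) * losses n \<sigma> (Suc k) (h @ [(y, x)]) j"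
          using offer.IH(2) ls(1) offer.prems 2 by (simp add: rel_of_snoc)
        show "Suc ?a \<le> card (worse_above n (rel_of (h @ [(y, x)])) (Suc k))"
          using ls(2) offer.prems 2 by (simp add: rel_of_snoc)
        show "?a < j" using False by simp
      qed
      then show ?thesis using sp(3) by (simp add: sp(1) distrib_left)
    next
      case 3
      have ch: "card (compatible n (h @ [(p, q)])) \<le> 2 ^ (j - ?a) * losses n \<sigma> (Suc k) (h @ [(p, q)]) j"
        if "worse_below n (rel_of (h @ [(p, q)])) (Suc k) = {} \<Longrightarrow> card (compatible n (h @ [(p, q)])) \<le>
            2 ^ (j - card (worse_above n (rel_of (h @ [(p, q)])) (Suc k))) * losses n \<sigma> (Suc k) (h @ [(p, q)]) j"
          and pq: "Suc k < p" "Suc k < q" "p \<in> alts n" for p q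
      proof (rule weaken_exponent)
        show "?a \<le> card (worse_above n (rel_of (h @ [(p, q)])) (Suc k))"
          unfolding rel_of_snoc by (intro card_mono finite_above extend_mono_above)
        show "card (compatible n (h @ [(p, q)])) \<le>
            2 ^ (j - card (worse_above n (rel_of (h @ [(p, q)])) (Suc k))) * losses n \<sigma> (Suc k) (h @ [(p, q)]) j"
          using that(1) extend_below_empty[OF R offer.prems pq] by (simp add: rel_of_snoc)
      qed
      have "card (compatible n (h @ [(x, y)])) \<le> 2 ^ (j - ?a) * losses n \<sigma> (Suc k) (h @ [(x, y)]) j"
        using ch[OF offer.IH(1)] 3 xy by simp
      moreover have "card (compatible n (h @ [(y, x)])) \<le> 2 ^ (j - ?a) * losses n \<sigma> (Suc k) (h @ [(y, x)]) j"
        using ch[OF offer.IH(2)] 3 xy by simp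
      ultimately show ?thesis using sp(2,3) by (simp add: sp(1) distrib_left)
    qed
  qed
qed

text \<open>The cases of \<open>losses_lower_bound\<close> with equality: a win in a top offer ends
  the insertion with fewer than \<open>j\<close> above, so that branch contributes nothing; a loss
  adds exactly one alternative; offers among worse ones leave a settled alternative as it
  is.\<close>

lemma losses_exact:
  assumes "is_strategy n \<sigma>" "top_offers_upto n \<sigma> (Suc k)" "Suc k \<le> n" "j \<le> n - Suc k" "reachable n \<sigma> h"
    and "worse_below n (rel_of h) (Suc k) = {}"
  shows "2 ^ (j - card (worse_above n (rel_of h) (Suc k))) * losses n \<sigma> (Suc k) h j =
    card (compatible n h)"
  using assms(1,5,6)
proof (induction rule: reachable_backward_induct)
  case (terminal h)
  have "j \<le> card (worse_above n (rel_of h) (Suc k))"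
    using card_above_terminal[OF terminal(2,3)] assms(3,4) by (simp add: alts_def)
  then show ?case using losses_full[OF assms(1) terminal(1)] by simp
next
  case (offer h x y)
  let ?a = "card (worse_above n (rel_of h) (Suc k))"
  note R = reachable_hist_under(1)[OF assms(1) offer.hyps(1)]
  note sp = losses_split[OF offer.hyps(4)]
  have top: "top_offers_upto n \<sigma> k" by (rule top_offers_upto_mono[OF assms(2)]) simp
  have xy: "x < y" "x \<in> alts n" "y \<in> alts n" "unranked n (rel_of h) y x"
    using offer.hyps(3,4) unranked_sym[of n "rel_of h"] by (auto simp: offers_def unranked_def)
  obtain W where W: "W \<in> tournaments n" "set h \<subseteq> W"
    using reachable_history[OF assms(1) offer.hyps(1)] .
  have st: "settled n W (rel_of h) (Suc k)"
    using reachable_settled[OF assms(1,2) offer.hyps(1) W(2)] by simp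
  show ?case
  proof (cases "j \<le> ?a")
    case True
    then show ?thesis using losses_full[OF assms(1) offer.hyps(1) True] by simp
  next
    case False
    consider "x \<le> k" | "x = Suc k" | "Suc k < x" by linarith
    then show ?thesis
    proof cases
      case 1
      note same = offer_by_better[OF assms(1) top offer.hyps 1]
      have "2 ^ (j - ?a) * losses n \<sigma> (Suc k) (h @ [(x, y)]) j = card (compatible n (h @ [(x, y)]))"
        using offer.IH(1) offer.prems same[of x y "Suc k"] by simp
      moreover have "2 ^ (j - ?a) * losses n \<sigma> (Suc k) (h @ [(y, x)]) j = card (compatible n (h @ [(y, x)]))"
        using offer.IH(2) offer.prems same[of y x "Suc k"] by simp
      ultimately show ?thesis using sp(2,3) by (simp add: sp(1) distrib_left)
    next
      case 2
      have tp: "\<forall>z\<in>L_set n (rel_of h) x. z = y \<or> (y, z) \<in> rel_of h"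
        using assms(2) offer.hyps(1-3) 2 unfolding top_offers_upto_def by blast
      have st': "settled n W (rel_of h) x" using st 2 by simp
      note win = extend_top_wins[OF R offer.hyps(4) xy(1) st' tp]
      note lose = extend_top_loses[OF R offer.hyps(4) xy(1) st' tp]
      have "losses n \<sigma> x (h @ [(x, y)]) j = 0"
      proof (rule losses_none[OF assms(1) _ _ xy(2)])
        show "reachable n \<sigma> (h @ [(x, y)])"
          using reachable.Snoc[OF offer.hyps(1-3)] by simp
        show "L_set n (rel_of (h @ [(x, y)])) x = {}" using win(2) by (simp add: rel_of_snoc)
        show "card (worse_above n (rel_of (h @ [(x, y)])) x) < j"
          using win(1) False 2 by (simp add: rel_of_snoc)
      qed
      moreover have "card (worse_above n (rel_of (h @ [(y, x)])) x) = Suc ?a"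
        using lose(1) offer.hyps(4) 2 by (simp add: rel_of_snoc worse_above_def unranked_def)
      moreover have "(2::nat) ^ (j - ?a) = 2 * 2 ^ (j - Suc ?a)"
        using False by (metis Suc_diff_Suc not_le power_Suc)
      moreover have "worse_below n (rel_of (h @ [(y, x)])) x = {}"
        using lose(2) by (simp add: rel_of_snoc)
      ultimately show ?thesis using sp(3) offer.IH(2) 2 by (simp add: sp(1))
    next
      case 3
      note xy' = extend_worse[OF R offer.hyps(4) _ _ st] and yx' = extend_worse[OF R xy(4) _ _ st]
      have "2 ^ (j - ?a) * losses n \<sigma> (Suc k) (h @ [(x, y)]) j = card (compatible n (h @ [(x, y)]))"
        using offer.IH(1) offer.prems xy'(1,2) 3 xy(1) by (simp add: rel_of_snoc)
      moreover have "2 ^ (j - ?a) * losses n \<sigma> (Suc k) (h @ [(y, x)]) j = card (compatible n (h @ [(y, x)]))"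
        using offer.IH(2) offer.prems yx'(1,2) 3 xy(1) by (simp add: rel_of_snoc)
      ultimately show ?thesis using sp(2,3) by (simp add: sp(1) distrib_left)
    qed
  qed
qed

section \<open>Strategies attaining the bounds\<close>

text \<open>A violating \<open>z\<close> could still be ranked above \<open>x\<close> after the win
  over \<open>y\<close>. A linear extension doing so is a compatible tournament, is its own outcome,
  and has one more alternative above \<open>x\<close>.\<close>

lemma top_if_no_loss_after_win:
  assumes "is_strategy n \<sigma>" "reachable n \<sigma> h" "unranked n (rel_of h) x y" "x < y"
    and "losses n \<sigma> x (h @ [(x, y)]) (Suc (card (worse_above n (rel_of h) x))) = 0"
  shows "\<forall>z\<in>L_set n (rel_of h) x. z = y \<or> (y, z) \<in> rel_of h"
proof (rule ccontr)
  let ?R = "rel_of h" and ?R' = "rel_of (h @ [(x, y)])"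
  assume "\<not> ?thesis"
  then obtain z where z: "z \<in> L_set n ?R x" "z \<noteq> y" "(y, z) \<notin> ?R" by blast
  note R = reachable_hist_under(1)[OF assms(1,2)]
  have R': "proto n ?R'" unfolding rel_of_snoc by (rule proto_extend[OF R assms(3)])
  have zx: "z \<in> alts n" "x < z" "x \<in> alts n" "(z, x) \<notin> ?R" "(x, z) \<notin> ?R"
    using z(1) by (simp_all add: L_set_def unranked_def)
  have "(y, x) \<notin> ?R" using assms(3) by (simp add: unranked_def)
  \<comment> \<open>The win places \<open>x\<close> only above \<open>y\<close> and what is below
    \<open>y\<close>, and \<open>z\<close> is neither.\<close>
  hence "unranked n ?R' z x"
    using z zx assms(4) by (simp add: rel_of_snoc unranked_def mem_extend)
  from linear_extension[OF proto_extend[OF R' this]]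
  obtain W where W: "proto n W" "W \<in> tournaments n" "extend z x ?R' \<subseteq> W" by metis
  have sub: "?R' \<subseteq> W" and zxW: "(z, x) \<in> W" using W(3) by (auto simp: extend_def)
  have "W \<in> compatible n (h @ [(x, y)])"
    using W(2) sub set_subset_rel_of[of "h @ [(x, y)]"] unfolding compatible_def by blast
  moreover have "Suc (card (worse_above n ?R x)) \<le> card (worse_above n W x)"
  proof -
    have "worse_above n ?R x \<subseteq> worse_above n W x"
      using worse_above_mono[of ?R W] sub by (simp add: rel_of_snoc extend_def)
    hence "insert z (worse_above n ?R x) \<subseteq> worse_above n W x"
      using zx zxW by (simp add: worse_above_def)
    moreover have "z \<notin> worse_above n ?R x" using zx by (simp add: worse_above_def)
    ultimately show ?thesis
      using card_mono[OF finite_above, of "insert z (worse_above n ?R x)"] by simp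
  qed
  ultimately have "W \<in> {W \<in> compatible n (h @ [(x, y)]).
      Suc (card (worse_above n ?R x)) \<le> card (worse_above n (outcome n \<sigma> W) x)}"
    using outcome_linear[OF assms(1) W(2,1)] by simp
  then show False using assms(5) unfolding losses_def by (simp add: card_eq_0_iff) blast
qed

text \<open>The reverse of the inequality in \<open>losses_lower_bound\<close>: where that lemma
  applies, its bounds are attained for all \<open>j\<close> at once.\<close>

definition tight :: "nat \<Rightarrow> strategy \<Rightarrow> alt \<Rightarrow> history \<Rightarrow> bool" where
  "tight n \<sigma> x h \<longleftrightarrow>
     (\<forall>j\<le>n - x. 2 ^ (j - card (worse_above n (rel_of h) x)) * losses n \<sigma> x h j \<le> card (compatible n h))"

text \<open>For \<open>j\<close> beyond the current number above, the lower bound on the losing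
  branch already uses up all that tightness allows for both. So the winning branch has no such
  losses, which forces a top offer, and the losing branch is tight itself.\<close>

lemma tight_own_offer:
  assumes "is_strategy n \<sigma>" "top_offers_upto n \<sigma> k" "Suc k \<le> n" "reachable n \<sigma> h" "\<not> terminal n h"
    and "offers \<sigma> h (Suc k) y" "unranked n (rel_of h) (Suc k) y"
    and "worse_below n (rel_of h) (Suc k) = {}" "tight n \<sigma> (Suc k) h"
  shows "\<forall>z\<in>L_set n (rel_of h) (Suc k). z = y \<or> (y, z) \<in> rel_of h"
    and "tight n \<sigma> (Suc k) (h @ [(y, Suc k)])"
proof -
  let ?K = "Suc k"
  let ?a = "card (worse_above n (rel_of h) ?K)"
  let ?hw = "h @ [(?K, y)]" and ?hl = "h @ [(y, ?K)]"
  let ?b = "card (worse_above n (rel_of ?hl) ?K)"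
  note R = reachable_hist_under(1)[OF assms(1,4)]
  have y: "?K < y" "y \<in> alts n" "?K \<in> alts n" "(y, ?K) \<notin> rel_of h"
    using assms(6,7) by (simp_all add: offers_def unranked_def)
  note ls = lost_comparison[OF R assms(7) y(1) assms(8)]
  note sp = losses_split[OF assms(7)]
  have reach: "reachable n \<sigma> ?hl"
    using reachable.Snoc[OF assms(4-6)] by simp
  have le: "Suc ?a \<le> ?b" using ls(2) by (simp add: rel_of_snoc)
  have "insert y (worse_above n (rel_of h) ?K) \<subseteq> {z \<in> alts n. ?K < z}"
    using y by (auto simp: worse_above_def)
  hence "card (insert y (worse_above n (rel_of h) ?K)) \<le> n - ?K"
    using card_mono[of "{z \<in> alts n. ?K < z}"] card_worse[OF y(3)] by simp
  moreover have "y \<notin> worse_above n (rel_of h) ?K" using y(4) by (simp add: worse_above_def)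
  \<comment> \<open>The offered \<open>y\<close> is worse and not yet above, so one more than the
    current number is still an admissible \<open>j\<close>.\<close>
  ultimately have am: "Suc ?a \<le> n - ?K" by simp
  have *: "losses n \<sigma> ?K ?hw j = 0 \<and> 2 ^ (j - ?a) * losses n \<sigma> ?K ?hl j \<le> card (compatible n h)"
    if j: "?a < j" "j \<le> n - ?K" for j
  proof -
    have "card (compatible n ?hl) \<le> 2 ^ (j - ?b) * losses n \<sigma> ?K ?hl j"
      using losses_lower_bound[OF assms(1-3) j(2) reach] ls(1) by (simp add: rel_of_snoc)
    from halving_bound[OF this le j(1)]
    have "card (compatible n h) \<le> 2 ^ (j - ?a) * losses n \<sigma> ?K ?hl j" using sp(3) by simp
    moreover have "2 ^ (j - ?a) * losses n \<sigma> ?K h j \<le> card (compatible n h)"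
      using assms(9) j by (simp add: tight_def)
    ultimately have "2 ^ (j - ?a) * losses n \<sigma> ?K ?hw j = 0 \<and>
        2 ^ (j - ?a) * losses n \<sigma> ?K ?hl j \<le> card (compatible n h)"
      unfolding sp(1) distrib_left by linarith
    then show ?thesis by simp
  qed
  show "\<forall>z\<in>L_set n (rel_of h) ?K. z = y \<or> (y, z) \<in> rel_of h"
    using top_if_no_loss_after_win[OF assms(1,4,7) y(1)] *[of "Suc ?a"] am by simp
  show "tight n \<sigma> ?K ?hl"
    unfolding tight_def
  proof (intro allI impI)
    fix j assume j: "j \<le> n - ?K"
    show "2 ^ (j - ?b) * losses n \<sigma> ?K ?hl j \<le> card (compatible n ?hl)"
    proof (cases "j \<le> ?a")
      case True
      then show ?thesis using le losses_le by simp
    next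
      case False
      hence "(2::nat) ^ (j - ?a) = 2 * 2 ^ (j - Suc ?a)"
        by (metis Suc_diff_Suc not_le power_Suc)
      hence "2 ^ (j - Suc ?a) * losses n \<sigma> ?K ?hl j \<le> card (compatible n ?hl)"
        using *[of j] j False sp(3) by simp
      moreover have "(2::nat) ^ (j - ?b) \<le> 2 ^ (j - Suc ?a)"
        using le by (intro power_increasing) auto
      ultimately show ?thesis by (meson le_trans mult_le_mono1)
    qed
  qed
qed

text \<open>The sibling takes at least its half of the bound, which leaves at most half for this
  branch.\<close>

lemma tight_child:
  assumes "is_strategy n \<sigma>" "top_offers_upto n \<sigma> k" "Suc k \<le> n"
    and "unranked n (rel_of h) p q" "reachable n \<sigma> (h @ [(q, p)])" "tight n \<sigma> (Suc k) h"
    and "worse_below n (rel_of (h @ [(q, p)])) (Suc k) = {}"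
  shows "tight n \<sigma> (Suc k) (h @ [(p, q)])"
  unfolding tight_def
proof (intro allI impI)
  let ?K = "Suc k"
  let ?a = "card (worse_above n (rel_of h) ?K)"
  let ?a1 = "card (worse_above n (rel_of (h @ [(p, q)])) ?K)"
  let ?a2 = "card (worse_above n (rel_of (h @ [(q, p)])) ?K)"
  note sp = losses_split[OF assms(4)]
  fix j assume j: "j \<le> n - ?K"
  have a: "?a \<le> ?a1" "?a \<le> ?a2"
    unfolding rel_of_snoc by (intro card_mono finite_above extend_mono_above)+
  have "card (compatible n (h @ [(q, p)])) \<le> 2 ^ (j - ?a) * losses n \<sigma> ?K (h @ [(q, p)]) j"
    using losses_lower_bound[OF assms(1-3) j assms(5,7)] a(2) by (rule weaken_exponent)
  moreover have "2 ^ (j - ?a) * losses n \<sigma> ?K h j \<le> card (compatible n h)"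
    using assms(6) j by (simp add: tight_def)
  ultimately have "2 ^ (j - ?a) * losses n \<sigma> ?K (h @ [(p, q)]) j \<le> card (compatible n (h @ [(p, q)]))"
    using sp(2,3) by (simp add: sp(1) distrib_left)
  moreover have "(2::nat) ^ (j - ?a1) \<le> 2 ^ (j - ?a)"
    using a by (intro power_increasing) auto
  ultimately show "2 ^ (j - ?a1) * losses n \<sigma> ?K (h @ [(p, q)]) j \<le> card (compatible n (h @ [(p, q)]))"
    by (meson le_trans mult_le_mono1)
qed

text \<open>Until its first win, \<open>Suc k\<close> has nothing worse below it and tightness is
  inherited. Tightness makes the win one against a top alternative, after which nothing worse is
  unranked with \<open>Suc k\<close>; later comparisons preserve this.\<close>

lemma tight_invariant:
  assumes "is_strategy n \<sigma>" "top_offers_upto n \<sigma> k" "Suc k \<le> n" "tight n \<sigma> (Suc k) []"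
    and "reachable n \<sigma> h"
  shows "L_set n (rel_of h) (Suc k) = {} \<or>
    worse_below n (rel_of h) (Suc k) = {} \<and> tight n \<sigma> (Suc k) h"
  using assms(5)
proof (induction rule: reachable.induct)
  case Nil
  then show ?case using assms(4) by (simp add: worse_below_def)
next
  case (Snoc h x y p q)
  let ?K = "Suc k"
  note R = reachable_hist_under(1)[OF assms(1) Snoc.hyps(1)]
  obtain u v where "offers \<sigma> h u v" "unranked n (rel_of h) u v"
    using reachable_offer[OF assms(1) Snoc.hyps(1,2)] .
  hence xy: "x < y" "unranked n (rel_of h) x y"
    using Snoc.hyps(3) by (auto simp: offers_def)
  hence pq: "unranked n (rel_of h) p q" "p \<in> alts n" "q \<in> alts n"
    using Snoc.hyps(4) unranked_sym[of n "rel_of h"] by (auto simp: unranked_def)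
  have qp: "(q, p) = (x, y) \<or> (q, p) = (y, x)" using Snoc.hyps(4) by auto
  note reach' = reachable.Snoc[OF Snoc.hyps(1-3) qp]
  show ?case
  proof (cases "L_set n (rel_of h) ?K = {}")
    case True
    then show ?thesis using L_set_extend[of n p q "rel_of h" ?K] by (simp add: rel_of_snoc)
  next
    case False
    hence b: "worse_below n (rel_of h) ?K = {}" and t: "tight n \<sigma> ?K h" using Snoc.IH by simp_all
    consider "x \<le> k" | "x = ?K" | "?K < x" by linarith
    then show ?thesis
    proof cases
      case 1
      note same = offer_by_better(2)[OF assms(1,2) Snoc.hyps(1-3) xy(2) 1]
      have "worse_below n (rel_of (h @ [(p, q)])) ?K = {}"
        and "worse_below n (rel_of (h @ [(q, p)])) ?K = {}"
        using same[OF Snoc.hyps(4), of ?K] same[OF qp, of ?K] b by simp_all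
      then show ?thesis using tight_child[OF assms(1-3) pq(1) reach' t] by simp
    next
      case 2
      have off: "offers \<sigma> h ?K y" and un: "unranked n (rel_of h) ?K y" and lt: "?K < y"
        using Snoc.hyps(3) xy 2 by simp_all
      note own = tight_own_offer[OF assms(1-3) Snoc.hyps(1,2) off un b t]
      from Snoc.hyps(4) show ?thesis
      proof
        assume w: "(p, q) = (x, y)"
        have "z \<notin> L_set n (extend ?K y (rel_of h)) ?K" if "z \<in> L_set n (rel_of h) ?K" for z
        proof -
          have "(?K, z) \<in> extend ?K y (rel_of h)" using own(1) that by (auto simp: mem_extend)
          then show ?thesis by (simp add: L_set_def unranked_def)
        qed
        hence "L_set n (extend ?K y (rel_of h)) ?K = {}" using L_set_extend by blast
        then show ?thesis using w 2 by (simp add: rel_of_snoc)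
      next
        assume "(p, q) = (y, x)"
        then show ?thesis using own(2) lost_comparison(1)[OF R un lt b] 2 by (simp add: rel_of_snoc)
      qed
    next
      case 3
      hence "?K < p" "?K < q" using Snoc.hyps(4) xy(1) by auto
      hence "worse_below n (rel_of (h @ [(p, q)])) ?K = {}"
        and "worse_below n (rel_of (h @ [(q, p)])) ?K = {}"
        unfolding rel_of_snoc using extend_below_empty[OF R b] pq(2,3) by simp_all
      then show ?thesis using tight_child[OF assms(1-3) pq(1) reach' t] by simp
    qed
  qed
qed

lemma tight_top_offers:
  assumes "is_strategy n \<sigma>" "top_offers_upto n \<sigma> k" "Suc k \<le> n" "tight n \<sigma> (Suc k) []"
  shows "top_offers_upto n \<sigma> (Suc k)"
  unfolding top_offers_upto_def
proof (intro allI impI, elim conjE)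
  fix h x y
  assume h: "reachable n \<sigma> h" "\<not> terminal n h" and off: "offers \<sigma> h x y" and "x \<le> Suc k"
  obtain u v where "offers \<sigma> h u v" "unranked n (rel_of h) u v"
    using reachable_offer[OF assms(1) h] .
  hence xy: "x < y" "unranked n (rel_of h) x y" using off by (auto simp: offers_def)
  show "\<forall>z\<in>L_set n (rel_of h) x. z = y \<or> (y, z) \<in> rel_of h"
  proof (cases "x = Suc k")
    case True
    then show ?thesis
      using tight_invariant[OF assms h(1)] tight_own_offer(1)[OF assms(1-3) h] off xy by auto
  next
    case False
    hence "x \<le> k" using \<open>x \<le> Suc k\<close> by simp
    then show ?thesis using assms(2) h off unfolding top_offers_upto_def by blast
  qed
qed

section \<open>From losses to \<open>better_for\<close> and the sets \<open>B_set\<close>\<close>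

lemma top_offers_losses_Nil:
  assumes "is_strategy n \<sigma>" "top_offers_upto n \<sigma> k" "Suc k \<le> n" "j \<le> n - Suc k"
  shows "card (tournaments n) \<le> 2 ^ j * losses n \<sigma> (Suc k) [] j"
    and "top_offers_upto n \<sigma> (Suc k) \<Longrightarrow> 2 ^ j * losses n \<sigma> (Suc k) [] j = card (tournaments n)"
proof -
  have [simp]: "worse_below n {} x = {}" "worse_above n {} x = {}" for x
    by (simp_all add: worse_below_def worse_above_def)
  have [simp]: "compatible n [] = tournaments n" by (simp add: compatible_def)
  show "card (tournaments n) \<le> 2 ^ j * losses n \<sigma> (Suc k) [] j"
    using losses_lower_bound[OF assms reachable.Nil] by simp
  show "2 ^ j * losses n \<sigma> (Suc k) [] j = card (tournaments n)" if "top_offers_upto n \<sigma> (Suc k)"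
    using losses_exact[OF assms(1) that assms(3,4) reachable.Nil] by simp
qed

lemma tight_Nil_iff:
  "tight n \<sigma> x [] \<longleftrightarrow> (\<forall>j\<le>n - x. 2 ^ j * losses n \<sigma> x [] j \<le> card (tournaments n))"
  by (simp add: tight_def compatible_def worse_above_def)

lemma N_count_plus_losses:
  assumes "is_strategy n \<sigma>" "x \<in> alts n" "W \<in> tournaments n"
  shows "N_count n \<sigma> x W + card (worse_above n (outcome n \<sigma> W) x) = n - x"
proof -
  let ?R = "outcome n \<sigma> W"
  note R = outcome_props(1,2)[OF assms(1,3)]
  have N: "N_count n \<sigma> x W = card (worse_below n ?R x)"
    by (simp add: N_count_def worse_below_def)
  have "L_set n ?R x = {}" using R(2) by (auto simp: L_set_def unranked_def is_total_def)
  hence "{z \<in> alts n. x < z} = worse_below n ?R x \<union> worse_above n ?R x"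
    using worse_partition[OF R(1) assms(2)] by (auto simp: worse_below_def worse_above_def)
  moreover have "worse_below n ?R x \<inter> worse_above n ?R x = {}"
    using proto_asym[OF R(1)] by (auto simp: worse_below_def worse_above_def)
  ultimately show ?thesis
    using card_Un_disjoint[OF finite_below finite_above] card_worse[OF assms(2)] N by metis
qed

text \<open>Wins and losses of \<open>x\<close> against worse alternatives sum to
  \<open>n - x\<close>, so \<open>n - x - j + 1\<close> wins or more means fewer than
  \<open>j\<close> losses; the two events partition the tournaments.\<close>

lemma card_N_count_ge:
  assumes "is_strategy n \<sigma>" "x \<in> alts n" "j \<le> n - x"
  shows "card {W \<in> tournaments n. Suc (n - x - j) \<le> N_count n \<sigma> x W} + losses n \<sigma> x [] j =
    card (tournaments n)"
proof -
  let ?P = "\<lambda>W. j \<le> card (worse_above n (outcome n \<sigma> W) x)"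
  have "Suc (n - x - j) \<le> N_count n \<sigma> x W \<longleftrightarrow> \<not> ?P W" if "W \<in> tournaments n" for W
    using N_count_plus_losses[OF assms(1,2) that] assms(3) by linarith
  hence "{W \<in> tournaments n. Suc (n - x - j) \<le> N_count n \<sigma> x W} = {W \<in> tournaments n. \<not> ?P W}"
    by blast
  moreover have "losses n \<sigma> x [] j = card {W \<in> tournaments n. ?P W}"
    by (simp add: losses_def compatible_def)
  moreover have "card {W \<in> tournaments n. \<not> ?P W} + card {W \<in> tournaments n. ?P W} =
      card ({W \<in> tournaments n. \<not> ?P W} \<union> {W \<in> tournaments n. ?P W})"
    by (rule card_Un_disjoint[symmetric]) auto
  moreover have "{W \<in> tournaments n. \<not> ?P W} \<union> {W \<in> tournaments n. ?P W} = tournaments n" by blast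
  ultimately show ?thesis by simp
qed

lemma better_for_iff_losses:
  assumes "is_strategy n \<sigma>" "is_strategy n \<tau>" "x \<in> alts n"
  shows "better_for n x \<sigma> \<tau> \<longleftrightarrow> (\<forall>j\<in>{1..n - x}. losses n \<sigma> x [] j \<le> losses n \<tau> x [] j)"
proof -
  let ?N = "\<lambda>\<sigma> k. card {W \<in> tournaments n. k \<le> N_count n \<sigma> x W}"
  have eq: "?N \<tau> (Suc (n - x - j)) \<le> ?N \<sigma> (Suc (n - x - j)) \<longleftrightarrow> losses n \<sigma> x [] j \<le> losses n \<tau> x [] j"
    if "j \<le> n - x" for j
    using card_N_count_ge[OF assms(1,3) that] card_N_count_ge[OF assms(2,3) that] by linarith
  have x: "1 \<le> x" "x \<le> n" using assms(3) by (auto simp: alts_def)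
  \<comment> \<open>Thresholds in \<open>better_for\<close> run up to \<open>n - 1\<close>, but only
    \<open>n - x\<close> alternatives are worse than \<open>x\<close>; beyond that the comparison is
    trivial.\<close>
  have none: "?N \<tau> k = 0" if "n - x < k" for k
  proof -
    have "\<not> k \<le> N_count n \<tau> x W" if "W \<in> tournaments n" for W
      using N_count_plus_losses[OF assms(2,3) that] \<open>n - x < k\<close> by linarith
    hence "{W \<in> tournaments n. k \<le> N_count n \<tau> x W} = {}" by blast
    then show ?thesis by simp
  qed
  show ?thesis
  proof
    assume b: "better_for n x \<sigma> \<tau>"
    show "\<forall>j\<in>{1..n - x}. losses n \<sigma> x [] j \<le> losses n \<tau> x [] j"
    proof
      fix j assume j: "j \<in> {1..n - x}"
      hence "Suc (n - x - j) \<in> {1..n - 1}" using x by auto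
      hence "?N \<tau> (Suc (n - x - j)) \<le> ?N \<sigma> (Suc (n - x - j))"
        using b unfolding better_for_def by blast
      then show "losses n \<sigma> x [] j \<le> losses n \<tau> x [] j" using eq j by simp
    qed
  next
    assume l: "\<forall>j\<in>{1..n - x}. losses n \<sigma> x [] j \<le> losses n \<tau> x [] j"
    show "better_for n x \<sigma> \<tau>"
      unfolding better_for_def
    proof
      fix k assume k: "k \<in> {1..n - 1}"
      show "?N \<tau> k \<le> ?N \<sigma> k"
      proof (cases "n - x < k")
        case True
        show ?thesis unfolding none[OF True] by simp
      next
        case False
        define j where "j = Suc (n - x - k)"
        have "j \<in> {1..n - x}" "k = Suc (n - x - j)" using k False by (auto simp: j_def)
        then show ?thesis using eq[of j] l by simp
      qed
    qed
  qed
qed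

text \<open>Insertion sort belongs to every class and attains the bounds, so a strategy best for
  \<open>Suc k\<close> loses no more and is tight. Conversely, attaining bounds valid throughout the
  class makes a strategy best in it.\<close>

lemma B_set_eq:
  assumes "k \<le> n"
  shows "B_set n k = {\<sigma>. is_strategy n \<sigma> \<and> top_offers_upto n \<sigma> k}"
  using assms
proof (induction k)
  case 0
  \<comment> \<open>Vacuous, as alternatives are numbered from 1.\<close>
  have "top_offers_upto n \<sigma> 0" for \<sigma>
    by (simp add: top_offers_upto_def L_set_def unranked_def alts_def)
  then show ?case by (simp add: strategies_def)
next
  case (Suc k)
  let ?S = "{\<sigma>. is_strategy n \<sigma> \<and> top_offers_upto n \<sigma> k}"
  have K: "Suc k \<in> alts n" "Suc k \<le> n" using Suc.prems by (simp_all add: alts_def)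
  have "best_among n (Suc k) ?S \<sigma> \<longleftrightarrow> top_offers_upto n \<sigma> (Suc k)" if \<sigma>: "\<sigma> \<in> ?S" for \<sigma>
  proof
    have s: "is_strategy n \<sigma>" "top_offers_upto n \<sigma> k" using \<sigma> by simp_all
    {
      let ?\<iota> = "insertion_sort n"
      note i = insertion_sort_is_strategy[of n] insertion_sort_top_offers[of n]
      assume "best_among n (Suc k) ?S \<sigma>"
      hence "better_for n (Suc k) \<sigma> ?\<iota>" using i by (simp add: best_among_def)
      hence le: "losses n \<sigma> (Suc k) [] j \<le> losses n ?\<iota> (Suc k) [] j" if "j \<in> {1..n - Suc k}" for j
        using that better_for_iff_losses[OF s(1) i(1) K(1)] by blast
      have "tight n \<sigma> (Suc k) []"
        unfolding tight_Nil_iff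
      proof (intro allI impI)
        fix j assume j: "j \<le> n - Suc k"
        show "2 ^ j * losses n \<sigma> (Suc k) [] j \<le> card (tournaments n)"
        \<comment> \<open>\<open>better_for\<close> says nothing about \<open>j = 0\<close>, where
          the bound is trivial.\<close>
        proof (cases "j = 0")
          case True
          then show ?thesis using losses_le[of n \<sigma> "Suc k" "[]" 0] by (simp add: compatible_def)
        next
          case False
          hence "2 ^ j * losses n \<sigma> (Suc k) [] j \<le> 2 ^ j * losses n ?\<iota> (Suc k) [] j"
            using le j by simp
          also have "\<dots> = card (tournaments n)"
            by (rule top_offers_losses_Nil(2)[OF i K(2) j i(2)])
          finally show ?thesis .
        qed
      qed
      then show "top_offers_upto n \<sigma> (Suc k)" by (rule tight_top_offers[OF s K(2)])
    }
    assume top: "top_offers_upto n \<sigma> (Suc k)"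
    have "better_for n (Suc k) \<sigma> \<tau>" if \<tau>: "\<tau> \<in> ?S" for \<tau>
    proof -
      have t: "is_strategy n \<tau>" "top_offers_upto n \<tau> k" using \<tau> by simp_all
      have "losses n \<sigma> (Suc k) [] j \<le> losses n \<tau> (Suc k) [] j" if "j \<in> {1..n - Suc k}" for j
      proof -
        have j: "j \<le> n - Suc k" using that by simp
        have "2 ^ j * losses n \<sigma> (Suc k) [] j \<le> 2 ^ j * losses n \<tau> (Suc k) [] j"
          using top_offers_losses_Nil(2)[OF s K(2) j top] top_offers_losses_Nil(1)[OF t K(2) j] by simp
        then show ?thesis by simp
      qed
      then show ?thesis using better_for_iff_losses[OF s(1) t(1) K(1)] by blast
    qed
    then show "best_among n (Suc k) ?S \<sigma>" using \<sigma> by (simp add: best_among_def)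
  qed
  moreover have "B_set n k = ?S" using Suc by simp
  moreover have "top_offers_upto n \<sigma> k" if "top_offers_upto n \<sigma> (Suc k)" for \<sigma>
    using top_offers_upto_mono[OF that, of k] by simp
  ultimately show ?case by auto
qed

text \<open>Within a class, \<open>best_among\<close> compares strategies through their outcomes
  only, and membership in the class is the induction hypothesis.\<close>

lemma outcome_equiv_B_set:
  assumes "outcome_equiv n \<sigma> \<tau>" "is_strategy n \<sigma>" "\<tau> \<in> B_set n k"
  shows "\<sigma> \<in> B_set n k"
  using assms(3)
proof (induction k)
  case 0
  then show ?case using assms(2) by (simp add: strategies_def)
next
  case (Suc k)
  have N: "N_count n \<sigma> x W = N_count n \<tau> x W" if "W \<in> tournaments n" for x W
    using assms(1) that by (simp add: outcome_equiv_def N_count_def)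
  have "{W \<in> tournaments n. j \<le> N_count n \<sigma> x W} = {W \<in> tournaments n. j \<le> N_count n \<tau> x W}" for j x
    using N by auto
  hence "better_for n x \<sigma> \<rho> \<longleftrightarrow> better_for n x \<tau> \<rho>" for x \<rho> by (simp add: better_for_def)
  then show ?case using Suc by (simp add: best_among_def)
qed

theorem theorem4:
  fixes n :: nat and \<sigma> :: strategy
  assumes "is_strategy n \<sigma>"
  shows "outcome_equiv n \<sigma> (insertion_sort n) \<longleftrightarrow> lexicographic n \<sigma>"
proof
  note i = insertion_sort_is_strategy[of n] insertion_sort_top_offers[of n]
  have sorting: "insertion_sort n \<in> B_set n k" if "k \<le> n" for k
    using i by (simp add: B_set_eq[OF that])
  {
    assume "outcome_equiv n \<sigma> (insertion_sort n)"
    then show "lexicographic n \<sigma>"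
      unfolding lexicographic_def
      using outcome_equiv_B_set[OF _ assms, of "insertion_sort n"] sorting by simp
  }
  assume "lexicographic n \<sigma>"
  hence "\<sigma> \<in> B_set n n" unfolding lexicographic_def by simp
  hence "top_offers_upto n \<sigma> n" by (simp add: B_set_eq)
  then show "outcome_equiv n \<sigma> (insertion_sort n)"
    using top_offers_outcome_unique[OF assms _ i] by (simp add: outcome_equiv_def)
qed

end
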